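(* Let $(c_n)$ be a sequence with $c_n>0$ and $c_n\to 0$, and put $p_n=c_n/n$. Let $f:\mathbb N\to\mathbb N$ satisfy $f(n)\to\infty$ and $$f(n)\bigl(\log f(n)+\log(1/c_n)\bigr)=o(\log n)\qquad(n\to\infty).$$ Put $H_n=\mathrm{Prune}_{f(n)}(G(n,p_n))$. Then $(H_n)$ has a first-order zero--one law. More precisely, for every quantifier rank $s$ and every fixed $K$, with probability tending to one as $n\to\infty$, $H_n$ is a forest, has no component of any bounded $s$-component type, and has at least $K$ components of every unbounded $s$-component type. Consequently, for every $s$ there is a deterministic $s$-theory of forests which $H_n$ has with probability tending to one. This $s$-theory is the one given by the following universal large-component forest profile: there are constants $B_s,M_s$ and a finite set $\Gamma_s^\infty$ of unbounded $s$-component types such that all finite forests having no component of order at most $B_s$ and at least $M_s$ components of each type in $\Gamma_s^\infty$ have the same $s$-theory, and this common $s$-theory is the $s$-theory of $H_n$ with probability tending to one.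
   Context: $G(n,p)$ is the random graph on vertex set $[n]=\{1,\dots,n\}$ in which each edge is present independently with probability $p$ (for finitely many small $n$ with $p_n>1$ the model may be defined arbitrarily). $\mathbb N$ denotes the positive integers. For a finite graph $G$ and an integer $m\ge 1$, $\mathrm{Prune}_m(G)$ is the subgraph of $G$ induced on $\{v\in V(G): |C_G(v)|\ge m\}$, where $C_G(v)$ is the connected component of $v$; that is, every component with fewer than $m$ vertices is deleted. First-order logic of graphs uses one binary symbol $E$ interpreted as symmetric irreflexive adjacency. A sequence of random graphs has a first-order zero--one law if for every first-order sentence $\varphi$ the probability that the $n$th graph satisfies $\varphi$ converges to $0$ or to $1$. The $s$-theory of a graph is the set of first-order sentences of quantifier rank at most $s$ true in it; $A\equiv_s B$ means that $A$ and $B$ have the same $s$-theory. There are finitely many $\equiv_s$-classes of finite trees; each such class (of trees) is called an $s$-component type. An $s$-component type is unbounded if it contains trees of arbitrarily large order (number of vertices), and bounded otherwise. *)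

theory Defs
  imports
    "HOL-Probability.Probability"
    "HOL-Probability.Product_PMF"
    "HOL-Library.Landau_Symbols"
    "Graph_Theory.Digraph_Component"
begin

section \<open>Finite simple graphs, components, forests\<close>

text \<open>
  A finite simple graph is a \<^typ>\<open>'a pair_pre_digraph\<close> satisfying \<^const>\<open>pair_graph\<close>:
  a finite vertex set and a symmetric irreflexive set of ordered pairs. The graph without
  vertices is allowed.
\<close>

definition induced_on :: "'a pair_pre_digraph \<Rightarrow> 'a set \<Rightarrow> 'a pair_pre_digraph" where
  "induced_on G W =
     \<lparr> pverts = pverts G \<inter> W, parcs = {(u, v) \<in> parcs G. u \<in> W \<and> v \<in> W} \<rparr>"

definition component_of :: "'a pair_pre_digraph \<Rightarrow> 'a \<Rightarrow> 'a set" where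
  "component_of G v = {u. v \<rightarrow>\<^sup>*\<^bsub>with_proj G\<^esub> u}"

definition components_of :: "'a pair_pre_digraph \<Rightarrow> 'a set set" where
  "components_of G = component_of G ` pverts G"

definition prune :: "nat \<Rightarrow> 'a pair_pre_digraph \<Rightarrow> 'a pair_pre_digraph" where
  "prune m G = induced_on G {v \<in> pverts G. m \<le> card (component_of G v)}"

text \<open>
  The library predicates \<^const>\<open>Digraph_Component.forest\<close> and \<^const>\<open>Digraph_Component.tree\<close>
  are about directed cycles; in a symmetric digraph every edge gives a directed cycle of length
  two, so they are not the graph-theoretic notions. The cycles of a simple graph are exactly the
  directed cycles of length at least three.
\<close>

definition is_forest :: "'a pair_pre_digraph \<Rightarrow> bool" where
  "is_forest G \<longleftrightarrow>
     pair_graph G \<and> \<not> (\<exists>p. pre_digraph.cycle (with_proj G) p \<and> 3 \<le> length p)"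

definition is_tree :: "'a pair_pre_digraph \<Rightarrow> bool" where
  "is_tree G \<longleftrightarrow> is_forest G \<and> Digraph_Component.connected (with_proj G)"


section \<open>First-order logic of graphs\<close>

datatype fo_formula =
    Falsum
  | Eq nat nat
  | Edge nat nat
  | Neg fo_formula
  | Conj fo_formula fo_formula
  | Ex nat fo_formula

primrec free_vars :: "fo_formula \<Rightarrow> nat set" where
  "free_vars Falsum = {}"
| "free_vars (Eq x y) = {x, y}"
| "free_vars (Edge x y) = {x, y}"
| "free_vars (Neg \<phi>) = free_vars \<phi>"
| "free_vars (Conj \<phi> \<psi>) = free_vars \<phi> \<union> free_vars \<psi>"
| "free_vars (Ex x \<phi>) = free_vars \<phi> - {x}"

primrec quantifier_rank :: "fo_formula \<Rightarrow> nat" where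
  "quantifier_rank Falsum = 0"
| "quantifier_rank (Eq x y) = 0"
| "quantifier_rank (Edge x y) = 0"
| "quantifier_rank (Neg \<phi>) = quantifier_rank \<phi>"
| "quantifier_rank (Conj \<phi> \<psi>) = max (quantifier_rank \<phi>) (quantifier_rank \<psi>)"
| "quantifier_rank (Ex x \<phi>) = Suc (quantifier_rank \<phi>)"

definition sentence :: "fo_formula \<Rightarrow> bool" where
  "sentence \<phi> \<longleftrightarrow> free_vars \<phi> = {}"

primrec sat :: "'a pair_pre_digraph \<Rightarrow> (nat \<Rightarrow> 'a) \<Rightarrow> fo_formula \<Rightarrow> bool" where
  "sat G \<sigma> Falsum \<longleftrightarrow> False"
| "sat G \<sigma> (Eq x y) \<longleftrightarrow> \<sigma> x = \<sigma> y"
| "sat G \<sigma> (Edge x y) \<longleftrightarrow> (\<sigma> x, \<sigma> y) \<in> parcs G"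
| "sat G \<sigma> (Neg \<phi>) \<longleftrightarrow> \<not> sat G \<sigma> \<phi>"
| "sat G \<sigma> (Conj \<phi> \<psi>) \<longleftrightarrow> sat G \<sigma> \<phi> \<and> sat G \<sigma> \<psi>"
| "sat G \<sigma> (Ex x \<phi>) \<longleftrightarrow> (\<exists>v \<in> pverts G. sat G (\<sigma>(x := v)) \<phi>)"

text \<open>
  Only used for sentences, whose truth value does not depend on the assignment. Assignments range
  over the whole type, so that this also gives the expected meaning in the graph without vertices.
\<close>

definition models :: "'a pair_pre_digraph \<Rightarrow> fo_formula \<Rightarrow> bool" where
  "models G \<phi> \<longleftrightarrow> (\<forall>\<sigma>. sat G \<sigma> \<phi>)"

definition s_theory :: "nat \<Rightarrow> 'a pair_pre_digraph \<Rightarrow> fo_formula set" where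
  "s_theory s G = {\<phi>. sentence \<phi> \<and> quantifier_rank \<phi> \<le> s \<and> models G \<phi>}"


section \<open>Component types\<close>

text \<open>
  Every finite tree is isomorphic to one with vertices in \<^typ>\<open>nat\<close>, so component types are
  classes of trees on natural numbers.
\<close>

definition tree_equiv :: "nat \<Rightarrow> nat pair_pre_digraph rel" where
  "tree_equiv s = {(A, B). is_tree A \<and> is_tree B \<and> s_theory s A = s_theory s B}"

definition component_types :: "nat \<Rightarrow> nat pair_pre_digraph set set" where
  "component_types s = {A. is_tree A} // tree_equiv s"

definition unbounded_type :: "nat pair_pre_digraph set \<Rightarrow> bool" where
  "unbounded_type \<tau> \<longleftrightarrow> (\<forall>N. \<exists>A \<in> \<tau>. N \<le> card (pverts A))"

definition num_components :: "nat pair_pre_digraph set \<Rightarrow> nat pair_pre_digraph \<Rightarrow> nat" where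
  "num_components \<tau> G = card {C \<in> components_of G. induced_on G C \<in> \<tau>}"

definition large_component_forests ::
    "nat \<Rightarrow> nat \<Rightarrow> nat pair_pre_digraph set set \<Rightarrow> nat pair_pre_digraph set" where
  "large_component_forests B M \<Gamma> =
     {F. is_forest F \<and> (\<forall>C \<in> components_of F. \<not> card C \<le> B) \<and>
         (\<forall>\<tau> \<in> \<Gamma>. M \<le> num_components \<tau> F)}"


section \<open>Random graphs\<close>

text \<open>
  The random graph on \<open>{1..n}\<close>; for \<open>p > 1\<close> the library's Bernoulli distribution uses \<open>1\<close>
  in place of \<open>p\<close>.
\<close>

definition gnp :: "nat \<Rightarrow> real \<Rightarrow> nat pair_pre_digraph pmf" where
  "gnp n p =
     map_pmf (\<lambda>X. \<lparr> pverts = {1..n},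
                     parcs = {(u, v). u \<in> {1..n} \<and> v \<in> {1..n} \<and> u \<noteq> v \<and> X {u, v}} \<rparr>)
       (Pi_pmf {e. e \<subseteq> {1..n} \<and> card e = 2} False (\<lambda>_. bernoulli_pmf p))"

definition pruned_gnp :: "(nat \<Rightarrow> real) \<Rightarrow> (nat \<Rightarrow> nat) \<Rightarrow> nat \<Rightarrow> nat pair_pre_digraph pmf" where
  "pruned_gnp c f n = map_pmf (prune (f n)) (gnp n (c n / real n))"

definition whp :: "(nat \<Rightarrow> 'a pmf) \<Rightarrow> ('a \<Rightarrow> bool) \<Rightarrow> bool" where
  "whp H P \<longleftrightarrow> (\<lambda>n. measure_pmf.prob (H n) {G. P G}) \<longlonglongrightarrow> 1"

definition zero_one_law :: "(nat \<Rightarrow> 'a pair_pre_digraph pmf) \<Rightarrow> bool" where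
  "zero_one_law H \<longleftrightarrow>
     (\<forall>\<phi>. sentence \<phi> \<longrightarrow>
        (\<lambda>n. measure_pmf.prob (H n) {G. models G \<phi>}) \<longlonglongrightarrow> 0 \<or>
        (\<lambda>n. measure_pmf.prob (H n) {G. models G \<phi>}) \<longlonglongrightarrow> 1)"

text \<open>Both sequences are indexed by the positive integers; their values at \<open>0\<close> are irrelevant.\<close>

definition pruning_regime :: "(nat \<Rightarrow> real) \<Rightarrow> (nat \<Rightarrow> nat) \<Rightarrow> bool" where
  "pruning_regime c f \<longleftrightarrow>
     (\<forall>n\<ge>1. 0 < c n) \<and> c \<longlonglongrightarrow> 0 \<and>
     (\<forall>n\<ge>1. 1 \<le> f n) \<and> filterlim f at_top sequentially \<and>
     (\<lambda>n. real (f n) * (ln (real (f n)) + ln (1 / c n))) \<in> o[sequentially](\<lambda>n. ln (real n))"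

end

theory Submission
  imports Defs "HOL-Real_Asymp.Real_Asymp" "HOL-Library.Transitive_Closure_Table"
begin

text \<open>
  The proof has a logical and a probabilistic half, which meet in the unbounded component types.

  \<^bold>\<open>Logic.\<close> Whether two graphs agree on all sentences of quantifier rank at most \<open>s\<close> is decided by the
  \<open>s\<close>-round back-and-forth game (\<open>s_theory_eq_iff_ef_type\<close>). Duplicator can play on parts
  without edges between them independently (\<open>ef_type_gjoin\<close>), and in \<open>s\<close> rounds \<open>s\<close> equivalent parts
  cannot be told from more than \<open>s\<close> (\<open>ef_type_copies\<close>). Hence the \<open>s\<close>-theory of a forest in which
  every type that occurs at all occurs at least \<open>s\<close> times depends only on the set of types that occur.
  The finitely many bounded types contain only trees up to some order \<open>B\<close>. So all forests
  whose components have more than \<open>B\<close> vertices, and which have at least \<open>s\<close> components of each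
  unbounded type, share one \<open>s\<close>-theory (\<open>large_component_forests_same_theory\<close>). It remains to
  show that the pruned random graph is such a forest with probability tending to one.

  \<^bold>\<open>Pumping.\<close> After pruning, only components with at least \<open>f n\<close> vertices are left. To see a
  given unbounded type one needs a tree of that type that is just above this threshold, since
  the expected number of copies of a tree decays at least exponentially in its order. Rooted trees are
  built from single vertices by one binary operation, which hangs one tree below the root of
  another, and the type of the result depends only on the types of the two arguments. The trees of
  a given type are therefore recognised by a finite algebra, and the pumping argument for tree
  automata gives a constant \<open>L\<close> such that each interval \<open>[N, N + L]\<close> contains the order of
  a tree of that type (\<open>unbounded_type_shapes\<close>).

  \<^bold>\<open>Probability.\<close> Put \<open>p = c/n\<close>. The expected number of cycles is at most the sum of \<open>c\<^sup>k\<close> over \<open>k \<ge> 3\<close>,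
  which tends to \<open>0\<close> with \<open>c\<close> (\<open>prob_not_forest_le\<close>). Fix a tree with \<open>m\<close> vertices, where
  \<open>f n \<le> m \<le> f n + L\<close>, and count the sets of \<open>m\<close> vertices that span a component which is a fixed
  labelled copy of the tree. The mean of this number is at least
  \<open>(n choose m) p\<^sup>m\<^sup>-\<^sup>1 (1 - p)\<^sup>n\<^sup>m\<close>, hence at least \<open>exp (ln n - m (ln m + ln (1/c) + 2))\<close>, and the growth
  condition on \<open>f\<close> makes this at least the square root of \<open>n\<close> (\<open>pruning_regime_eventually\<close>). Copies on
  different sets that meet exclude each other, and copies on disjoint sets are almost
  independent because they share at most \<open>m\<^sup>2\<close> potential edges (\<open>prob_two_isolated_copies\<close>), so
  Chebyshev's inequality gives any fixed number of copies with probability tending to one.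
\<close>

section \<open>Back-and-forth types\<close>

text \<open>
  The position of the \<open>s\<close>-round back-and-forth game on \<open>G\<close> with the elements \<open>as\<close> already chosen,
  up to equivalence: for finite graphs and equally many chosen elements, two positions get the same
  number exactly when Duplicator wins. Rank \<open>0\<close> records
  the atomic diagram of \<open>as\<close>, rank \<open>s + 1\<close> the set of types of the one-element extensions. The
  type of rank \<open>s\<close> is kept as a first component so that equality passes down to lower ranks even
  when there is no vertex left to play. Numbers in place of nested sets give all ranks one HOL
  type, and finiteness of the number of types becomes finiteness of a set of numbers.
\<close>

primrec ef_type :: "nat \<Rightarrow> 'a pair_pre_digraph \<Rightarrow> 'a list \<Rightarrow> nat" where
  "ef_type 0 G as =
     to_nat (map (\<lambda>(i, j). (as ! i = as ! j, (as ! i, as ! j) \<in> parcs G))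
       (List.product [0..<length as] [0..<length as]))"
| "ef_type (Suc s) G as =
     prod_encode (ef_type s G as, set_encode ((\<lambda>a. ef_type s G (a # as)) ` pverts G))"

lemma ef_type_0_eq:
  assumes "length as = length bs"
  shows "ef_type 0 G as = ef_type 0 H bs \<longleftrightarrow>
    (\<forall>(x, x') \<in> set (zip as bs). \<forall>(y, y') \<in> set (zip as bs).
       (x = y) = (x' = y') \<and> ((x, y) \<in> parcs G) = ((x', y') \<in> parcs H))"
proof -
  define P where "P = (\<lambda>x x' y y'. (x = y) = (x' = y') \<and> ((x, y) \<in> parcs G) = ((x', y') \<in> parcs H))"
  have "ef_type 0 G as = ef_type 0 H bs \<longleftrightarrow>
      (\<forall>i<length as. \<forall>j<length as. P (as ! i) (bs ! i) (as ! j) (bs ! j))"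
    unfolding P_def ef_type.simps assms[symmetric] to_nat_split map_eq_conv by auto
  also have "\<dots> \<longleftrightarrow> (\<forall>p \<in> set (zip as bs). \<forall>q \<in> set (zip as bs). P (fst p) (snd p) (fst q) (snd q))"
    using assms by (simp add: all_set_conv_all_nth)
  finally show ?thesis unfolding P_def by (simp add: case_prod_beta)
qed

lemma ef_type_0_D:
  assumes "ef_type 0 G as = ef_type 0 H bs" "length as = length bs"
    and "(x, x') \<in> set (zip as bs)" "(y, y') \<in> set (zip as bs)"
  shows "(x = y) = (x' = y') \<and> ((x, y) \<in> parcs G) = ((x', y') \<in> parcs H)"
  using bspec[OF bspec[OF assms(1)[unfolded ef_type_0_eq[OF assms(2)]] assms(3), unfolded case_prod_conv]
      assms(4)] by simp

lemma image_eq_image_iff: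
  "f ` A = g ` B \<longleftrightarrow> (\<forall>a\<in>A. \<exists>b\<in>B. f a = g b) \<and> (\<forall>b\<in>B. \<exists>a\<in>A. f a = g b)"
  unfolding set_eq_subset image_subset_iff image_iff by (auto simp: eq_commute)

lemma ef_type_Suc_eq:
  assumes "finite (pverts G)" "finite (pverts H)"
  shows "ef_type (Suc s) G as = ef_type (Suc s) H bs \<longleftrightarrow>
    ef_type s G as = ef_type s H bs \<and>
    (\<forall>a\<in>pverts G. \<exists>b\<in>pverts H. ef_type s G (a # as) = ef_type s H (b # bs)) \<and>
    (\<forall>b\<in>pverts H. \<exists>a\<in>pverts G. ef_type s G (a # as) = ef_type s H (b # bs))"
proof -
  have "set_encode ((\<lambda>a. ef_type s G (a # as)) ` pverts G) =
        set_encode ((\<lambda>b. ef_type s H (b # bs)) ` pverts H) \<longleftrightarrow>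
        (\<lambda>a. ef_type s G (a # as)) ` pverts G = (\<lambda>b. ef_type s H (b # bs)) ` pverts H"
    using assms by (intro set_encode_eq) auto
  then show ?thesis unfolding ef_type.simps prod_encode_eq prod.inject image_eq_image_iff by simp
qed

lemma ef_type_downward:
  "ef_type (Suc s) G as = ef_type (Suc s) H bs \<Longrightarrow> ef_type s G as = ef_type s H bs"
  by simp

declare ef_type.simps [simp del]

text \<open>
  A quantifier in the formula is matched by one round of the game.
\<close>

lemma sat_ef_type_cong:
  assumes "ef_type s G as = ef_type s H bs" "length as = length bs"
    and "finite (pverts G)" "finite (pverts H)"
    and "quantifier_rank \<phi> \<le> s"
    and "\<forall>x\<in>free_vars \<phi>. (\<sigma> x, \<rho> x) \<in> set (zip as bs)"
  shows "sat G \<sigma> \<phi> \<longleftrightarrow> sat H \<rho> \<phi>"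
  using assms
proof (induction \<phi> arbitrary: s as bs \<sigma> \<rho>)
  case (Eq x y)
  have "ef_type 0 G as = ef_type 0 H bs"
    using Eq(1) by (induction s) (auto dest: ef_type_downward)
  then show ?case using Eq by (fastforce simp: ef_type_0_eq)
next
  case (Edge x y)
  have "ef_type 0 G as = ef_type 0 H bs"
    using Edge(1) by (induction s) (auto dest: ef_type_downward)
  then show ?case using Edge by (fastforce simp: ef_type_0_eq)
next
  case (Neg \<phi>)
  from Neg.IH[of s as bs \<sigma> \<rho>] Neg.prems show ?case by simp
next
  case (Conj \<phi> \<psi>)
  from Conj.IH(1)[of s as bs \<sigma> \<rho>] Conj.IH(2)[of s as bs \<sigma> \<rho>] Conj.prems show ?case by simp
next
  case (Ex x \<phi>)
  then obtain s' where s: "s = Suc s'" by (cases s) auto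
  have *: "sat G (\<sigma>(x := a)) \<phi> \<longleftrightarrow> sat H (\<rho>(x := b)) \<phi>"
    if "ef_type s' G (a # as) = ef_type s' H (b # bs)" for a b
    using Ex.prems that by (intro Ex.IH[of s' "a # as" "b # bs"]) (auto simp: s)
  from Ex.prems(1) show ?case
    unfolding s ef_type_Suc_eq[OF Ex.prems(3,4)] using * by simp metis
qed simp

lemma s_theory_eqI:
  assumes "ef_type s G [] = ef_type s H []" "finite (pverts G)" "finite (pverts H)"
  shows "s_theory s G = s_theory s H"
proof -
  have "models G \<phi> \<longleftrightarrow> models H \<phi>" if "sentence \<phi>" "quantifier_rank \<phi> \<le> s" for \<phi>
  proof -
    have "sat G \<sigma> \<phi> \<longleftrightarrow> sat H \<rho> \<phi>" for \<sigma> \<rho>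
      using that assms by (intro sat_ef_type_cong[of s _ "[]" _ "[]"]) (auto simp: sentence_def)
    then show ?thesis unfolding models_def by blast
  qed
  then show ?thesis unfolding s_theory_def by blast
qed

text \<open>
  At each rank a type is determined by a type and a set of types of the previous rank, so finiteness
  is inherited.
\<close>

lemma finitely_many_ef_types:
  "finite {ef_type s G as | (G :: 'a pair_pre_digraph) as. length as = k}"
proof (induction s arbitrary: k)
  case 0
  have "{ef_type 0 G as | (G :: 'a pair_pre_digraph) as. length as = k}
          \<subseteq> to_nat ` {xs :: (bool \<times> bool) list. set xs \<subseteq> UNIV \<and> length xs = k * k}"
    by (auto simp: ef_type.simps intro!: imageI)
  moreover have "finite {xs :: (bool \<times> bool) list. set xs \<subseteq> UNIV \<and> length xs = k * k}"
    by (rule finite_lists_length_eq) simp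
  ultimately show ?case by (meson finite_imageI finite_subset)
next
  case (Suc s)
  let ?A = "\<lambda>k. {ef_type s G as | (G :: 'a pair_pre_digraph) as. length as = k}"
  have "{ef_type (Suc s) G as | (G :: 'a pair_pre_digraph) as. length as = k}
          \<subseteq> prod_encode ` (?A k \<times> set_encode ` Pow (?A (Suc k)))"
    by (fastforce simp: ef_type.simps intro!: imageI)
  moreover have "finite (prod_encode ` (?A k \<times> set_encode ` Pow (?A (Suc k))))"
    using Suc.IH by auto
  ultimately show ?case by (rule finite_subset)
qed

section \<open>Theories of bounded rank determine types\<close>

definition conj_list :: "fo_formula list \<Rightarrow> fo_formula" where
  "conj_list \<phi>s = foldr Conj \<phi>s (Neg Falsum)"

lemma conj_list [simp]:
  "sat G \<sigma> (conj_list \<phi>s) \<longleftrightarrow> (\<forall>\<phi>\<in>set \<phi>s. sat G \<sigma> \<phi>)"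
  "free_vars (conj_list \<phi>s) = (\<Union>\<phi>\<in>set \<phi>s. free_vars \<phi>)"
  "quantifier_rank (conj_list \<phi>s) \<le> s \<longleftrightarrow> (\<forall>\<phi>\<in>set \<phi>s. quantifier_rank \<phi> \<le> s)"
  unfolding conj_list_def by (induction \<phi>s) auto

lemma finite_conjunction:
  assumes "finite I" "\<And>i. i \<in> I \<Longrightarrow> free_vars (\<phi> i) \<subseteq> X \<and> quantifier_rank (\<phi> i) \<le> s"
  obtains \<psi> where "free_vars \<psi> \<subseteq> X" "quantifier_rank \<psi> \<le> s"
    "\<And>(G :: 'a pair_pre_digraph) \<sigma>. sat G \<sigma> \<psi> \<longleftrightarrow> (\<forall>i\<in>I. sat G \<sigma> (\<phi> i))"
proof -
  from assms(1) obtain xs where xs: "set xs = I" using finite_list by blast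
  show thesis
    using assms(2) by (intro that[of "conj_list (map \<phi> xs)"]) (auto simp: xs)
qed

text \<open>
  Hintikka formulas. The type of rank \<open>s + 1\<close> says which of the finitely many types of rank \<open>s\<close> are
  realised by an additional element, and that is a finite conjunction of statements
  \<open>\<exists>x\<^sub>k. \<phi>\<^sub>u\<close> and their negations. The element chosen last is the head of the list of chosen
  elements and is named by the variable with the highest index, whence the reversal of \<open>[0..<k]\<close>.
\<close>

lemma hintikka_formula:
  "\<exists>\<phi>. free_vars \<phi> \<subseteq> {..<k} \<and> quantifier_rank \<phi> \<le> s \<and>
     (\<forall>(G :: 'a pair_pre_digraph) \<sigma>. finite (pverts G) \<longrightarrow>
        (sat G \<sigma> \<phi> \<longleftrightarrow> ef_type s G (map \<sigma> (rev [0..<k])) = t))"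
proof (induction s arbitrary: k t)
  case 0
  show ?case
  proof (cases "\<exists>(H :: 'a pair_pre_digraph) \<rho>. ef_type 0 H (map \<rho> (rev [0..<k])) = t")
    case False
    then show ?thesis by (intro exI[of _ Falsum]) auto
  next
    case True
    then obtain H :: "'a pair_pre_digraph" and \<rho>
      where t: "t = ef_type 0 H (map \<rho> (rev [0..<k]))" by auto
    \<comment> \<open>literals with prescribed truth value\<close>
    define lit where "lit = (\<lambda>b \<phi>. if b then \<phi> else Neg \<phi>)"
    have lit: "free_vars (lit b \<phi>) = free_vars \<phi>" "quantifier_rank (lit b \<phi>) = quantifier_rank \<phi>"
      "sat G \<sigma> (lit b \<phi>) \<longleftrightarrow> (sat G \<sigma> \<phi> \<longleftrightarrow> b)" for b \<phi> and G :: "'a pair_pre_digraph" and \<sigma>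
      by (auto simp: lit_def)
    define \<phi> where "\<phi> = (\<lambda>(i, j). Conj (lit (\<rho> i = \<rho> j) (Eq i j)) (lit ((\<rho> i, \<rho> j) \<in> parcs H) (Edge i j)))"
    obtain \<psi> where \<psi>: "free_vars \<psi> \<subseteq> {..<k}" "quantifier_rank \<psi> \<le> 0"
      "\<And>(G :: 'a pair_pre_digraph) \<sigma>. sat G \<sigma> \<psi> \<longleftrightarrow> (\<forall>p\<in>{..<k} \<times> {..<k}. sat G \<sigma> (\<phi> p))"
    proof (rule finite_conjunction[of "{..<k} \<times> {..<k}" \<phi> "{..<k}" 0])
      show "free_vars (\<phi> p) \<subseteq> {..<k} \<and> quantifier_rank (\<phi> p) \<le> 0"
        if "p \<in> {..<k} \<times> {..<k}" for p
        using that by (auto simp: \<phi>_def lit)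
    qed auto
    have "sat G \<sigma> \<psi> \<longleftrightarrow> ef_type 0 G (map \<sigma> (rev [0..<k])) = t"
      for G :: "'a pair_pre_digraph" and \<sigma>
    proof -
      have "set (zip (map \<sigma> (rev [0..<k])) (map \<rho> (rev [0..<k]))) = (\<lambda>i. (\<sigma> i, \<rho> i)) ` {..<k}"
        by (auto simp: zip_map_map zip_same_conv_map)
      then have "ef_type 0 G (map \<sigma> (rev [0..<k])) = t \<longleftrightarrow>
          (\<forall>i<k. \<forall>j<k. (\<sigma> i = \<sigma> j) = (\<rho> i = \<rho> j) \<and> ((\<sigma> i, \<sigma> j) \<in> parcs G) = ((\<rho> i, \<rho> j) \<in> parcs H))"
        unfolding t by (subst ef_type_0_eq) auto
      also have "\<dots> \<longleftrightarrow> sat G \<sigma> \<psi>"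
        unfolding \<psi>(3) by (auto simp: \<phi>_def lit)
      finally show ?thesis ..
    qed
    with \<psi> show ?thesis by (intro exI[of _ \<psi>]) blast
  qed
next
  case (Suc s)
  obtain t1 T where t: "t = prod_encode (t1, T)" by (metis prod_decode_inverse surj_pair)
  define A where "A = {ef_type s G as | (G :: 'a pair_pre_digraph) as. length as = Suc k}"
  have finA: "finite A" unfolding A_def by (rule finitely_many_ef_types)
  from Suc.IH[of k t1] obtain \<phi>1 where \<phi>1: "free_vars \<phi>1 \<subseteq> {..<k}" "quantifier_rank \<phi>1 \<le> s"
    "\<And>(G :: 'a pair_pre_digraph) \<sigma>. finite (pverts G) \<Longrightarrow>
        sat G \<sigma> \<phi>1 \<longleftrightarrow> ef_type s G (map \<sigma> (rev [0..<k])) = t1" by blast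
  from Suc.IH[of "Suc k"] obtain \<phi> where \<phi>:
    "\<And>u. free_vars (\<phi> u) \<subseteq> {..<Suc k}" "\<And>u. quantifier_rank (\<phi> u) \<le> s"
    "\<And>u (G :: 'a pair_pre_digraph) \<sigma>. finite (pverts G) \<Longrightarrow>
        sat G \<sigma> (\<phi> u) \<longleftrightarrow> ef_type s G (map \<sigma> (rev [0..<Suc k])) = u" by metis
  define lit where "lit = (\<lambda>u. if u \<in> set_decode T then Ex k (\<phi> u) else Neg (Ex k (\<phi> u)))"
  have ext: "sat G \<sigma> (Ex k (\<phi> u)) \<longleftrightarrow>
      u \<in> (\<lambda>a. ef_type s G (a # map \<sigma> (rev [0..<k]))) ` pverts G"
    if "finite (pverts G)" for G :: "'a pair_pre_digraph" and \<sigma> u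
    using that by (auto simp: \<phi>(3))
  have "free_vars (\<phi> u) - {k} \<subseteq> {..<k}" for u using \<phi>(1)[of u] by (auto simp: lessThan_Suc)
  then have "free_vars (lit u) \<subseteq> {..<k} \<and> quantifier_rank (lit u) \<le> Suc s" for u
    using \<phi>(2)[of u] by (simp add: lit_def)
  then obtain \<psi> where \<psi>: "free_vars \<psi> \<subseteq> {..<k}" "quantifier_rank \<psi> \<le> Suc s"
      "\<And>(G :: 'a pair_pre_digraph) \<sigma>. sat G \<sigma> \<psi> \<longleftrightarrow> (\<forall>u\<in>A. sat G \<sigma> (lit u))"
    by (rule finite_conjunction[OF finA, of lit "{..<k}" "Suc s"]) auto
  have inA: "ef_type s G (a # map \<sigma> (rev [0..<k])) \<in> A"
    for G :: "'a pair_pre_digraph" and a \<sigma>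
    unfolding A_def by (intro CollectI exI[of _ G] exI[of _ "a # map \<sigma> (rev [0..<k])"]) simp
  show ?case
  proof (cases "finite (set_decode T) \<and> set_decode T \<subseteq> A")
    case False
    have "ef_type (Suc s) G (map \<sigma> (rev [0..<k])) \<noteq> t"
      if "finite (pverts G)" for G :: "'a pair_pre_digraph" and \<sigma>
    proof
      assume "ef_type (Suc s) G (map \<sigma> (rev [0..<k])) = t"
      then have "T = set_encode ((\<lambda>a. ef_type s G (a # map \<sigma> (rev [0..<k]))) ` pverts G)"
        by (auto simp: t ef_type.simps)
      then have "set_decode T = (\<lambda>a. ef_type s G (a # map \<sigma> (rev [0..<k]))) ` pverts G"
        using that by (simp add: set_encode_inverse)
      then show False using False that inA by auto
    qed
    then show ?thesis by (intro exI[of _ Falsum]) auto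
  next
    case True
    have "sat G \<sigma> (Conj \<phi>1 \<psi>) \<longleftrightarrow> ef_type (Suc s) G (map \<sigma> (rev [0..<k])) = t"
      if fin: "finite (pverts G)" for G :: "'a pair_pre_digraph" and \<sigma>
    proof -
      let ?E = "(\<lambda>a. ef_type s G (a # map \<sigma> (rev [0..<k]))) ` pverts G"
      have "?E \<subseteq> A" using inA by auto
      have "sat G \<sigma> \<psi> \<longleftrightarrow> (\<forall>u\<in>A. u \<in> set_decode T \<longleftrightarrow> u \<in> ?E)"
        unfolding \<psi>(3)
      proof (intro ball_cong refl)
        fix u
        have "sat G \<sigma> (lit u) \<longleftrightarrow> (sat G \<sigma> (Ex k (\<phi> u)) \<longleftrightarrow> u \<in> set_decode T)"
          by (simp add: lit_def)
        then show "sat G \<sigma> (lit u) \<longleftrightarrow> (u \<in> set_decode T \<longleftrightarrow> u \<in> ?E)"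
          unfolding ext[OF fin] by blast
      qed
      also have "\<dots> \<longleftrightarrow> ?E = set_decode T"
        using True \<open>?E \<subseteq> A\<close> by blast
      also have "\<dots> \<longleftrightarrow> set_encode ?E = T"
        using fin set_encode_inverse[of ?E] set_decode_inverse[of T] by auto
      finally show ?thesis
        using \<phi>1(3)[OF fin] by (simp add: t ef_type.simps)
    qed
    then show ?thesis using \<phi>1 \<psi> by (intro exI[of _ "Conj \<phi>1 \<psi>"]) auto
  qed
qed

lemma s_theory_eq_iff_ef_type:
  fixes G H :: "'a pair_pre_digraph"
  assumes "finite (pverts G)" "finite (pverts H)"
  shows "s_theory s G = s_theory s H \<longleftrightarrow> ef_type s G [] = ef_type s H []"
proof
  assume eq: "s_theory s G = s_theory s H"
  from hintikka_formula[of 0 s "ef_type s G []"] obtain \<phi>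
    where \<phi>: "sentence \<phi>" "quantifier_rank \<phi> \<le> s"
      "\<And>(G' :: 'a pair_pre_digraph) \<sigma>. finite (pverts G') \<Longrightarrow>
        sat G' \<sigma> \<phi> \<longleftrightarrow> ef_type s G' [] = ef_type s G []"
    by (auto simp: sentence_def)
  have "\<phi> \<in> s_theory s G" using \<phi> assms by (auto simp: s_theory_def models_def)
  then have "models H \<phi>" unfolding eq by (simp add: s_theory_def)
  then show "ef_type s G [] = ef_type s H []" using \<phi>(3) assms by (auto simp: models_def)
qed (rule s_theory_eqI[OF _ assms])

section \<open>Composition of back-and-forth types\<close>

text \<open>
  A loop at a vertex serves as a mark. The parts are put side by side, marked vertices of different
  parts are made adjacent, and the marks of the second part are erased. For loopless graphs this is
  the disjoint union; for two trees marked at their roots it hangs the second tree below the root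
  of the first, and the result is again marked at its root. One composition lemma thus covers both.
\<close>

definition gjoin :: "'a pair_pre_digraph \<Rightarrow> 'a pair_pre_digraph \<Rightarrow> 'a pair_pre_digraph" where
  "gjoin G H =
     \<lparr> pverts = pverts G \<union> pverts H,
       parcs = parcs G \<union> {(x, y) \<in> parcs H. x \<noteq> y} \<union>
         {(x, y). (x, x) \<in> parcs G \<and> (y, y) \<in> parcs H} \<union>
         {(x, y). (x, x) \<in> parcs H \<and> (y, y) \<in> parcs G} \<rparr>"

text \<open>
  Graphs with marks are not simple graphs, so only this much can be required of them.
\<close>

definition finite_wf :: "'a pair_pre_digraph \<Rightarrow> bool" where
  "finite_wf G \<longleftrightarrow> finite (pverts G) \<and> parcs G \<subseteq> pverts G \<times> pverts G"

lemma gjoin_arc_iff: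
  assumes "finite_wf G" "finite_wf H" "pverts G \<inter> pverts H = {}"
  shows "(x, y) \<in> parcs (gjoin G H) \<longleftrightarrow>
    (if x \<in> pverts G then if y \<in> pverts G then (x, y) \<in> parcs G
       else (x, x) \<in> parcs G \<and> (y, y) \<in> parcs H
     else if y \<in> pverts G then (y, y) \<in> parcs G \<and> (x, x) \<in> parcs H
       else (x, y) \<in> parcs H \<and> x \<noteq> y)"
proof -
  have *: "u \<in> pverts G" "v \<in> pverts G" if "(u, v) \<in> parcs G" for u v
    using assms(1) that by (auto simp: finite_wf_def)
  have **: "u \<notin> pverts G" "v \<notin> pverts G" if "(u, v) \<in> parcs H" for u v
    using assms(2,3) that by (auto simp: finite_wf_def)
  show ?thesis unfolding gjoin_def by (auto dest: * **)
qed

lemma set_zip_filter: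
  assumes "list_all2 (\<lambda>a b. P a \<longleftrightarrow> Q b) as bs"
  shows "set (zip (filter P as) (filter Q bs)) = {(a, b) \<in> set (zip as bs). P a}"
    and "length (filter P as) = length (filter Q bs)"
  using assms by (induction rule: list_all2_induct) auto

text \<open>
  Duplicator answers each move in the corresponding part, by the strategy for that part. Whether two
  elements of different parts are adjacent depends only on whether they are marked, which the
  atomic diagrams of the two parts record.
\<close>

lemma ef_type_gjoin:
  assumes on: "finite_wf G1" "finite_wf G2" "finite_wf H1" "finite_wf H2"
    and disj: "pverts G1 \<inter> pverts G2 = {}" "pverts H1 \<inter> pverts H2 = {}"
    and as: "list_all2 (\<lambda>a b. (a \<in> pverts G1 \<and> b \<in> pverts H1) \<or> (a \<in> pverts G2 \<and> b \<in> pverts H2)) as bs"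
    and "ef_type s G1 (filter (\<lambda>a. a \<in> pverts G1) as) = ef_type s H1 (filter (\<lambda>b. b \<in> pverts H1) bs)"
    and "ef_type s G2 (filter (\<lambda>a. a \<in> pverts G2) as) = ef_type s H2 (filter (\<lambda>b. b \<in> pverts H2) bs)"
  shows "ef_type s (gjoin G1 G2) as = ef_type s (gjoin H1 H2) bs"
  using as assms(8,9)
proof (induction s arbitrary: as bs)
  case 0
  let ?Z = "set (zip as bs)"
  have l1: "list_all2 (\<lambda>a b. a \<in> pverts G1 \<longleftrightarrow> b \<in> pverts H1) as bs"
    using "0.prems"(1) by (rule list_all2_mono) (use disj in auto)
  have l2: "list_all2 (\<lambda>a b. a \<in> pverts G2 \<longleftrightarrow> b \<in> pverts H2) as bs"
    using "0.prems"(1) by (rule list_all2_mono) (use disj in auto)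
  have side: "(x \<in> pverts G1 \<and> x' \<in> pverts H1) \<or> (x \<in> pverts G2 \<and> x' \<in> pverts H2)"
    if "(x, x') \<in> ?Z" for x x'
    using "0.prems"(1) that by (auto simp: list_all2_iff)
  have e1: "(x = y) = (x' = y') \<and> ((x, y) \<in> parcs G1) = ((x', y') \<in> parcs H1)"
    if "(x, x') \<in> ?Z" "(y, y') \<in> ?Z" "x \<in> pverts G1" "y \<in> pverts G1" for x x' y y'
    using that by (intro ef_type_0_D[OF "0.prems"(2) set_zip_filter(2)[OF l1]])
      (auto simp: set_zip_filter(1)[OF l1])
  have e2: "(x = y) = (x' = y') \<and> ((x, y) \<in> parcs G2) = ((x', y') \<in> parcs H2)"
    if "(x, x') \<in> ?Z" "(y, y') \<in> ?Z" "x \<in> pverts G2" "y \<in> pverts G2" for x x' y y'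
    using that by (intro ef_type_0_D[OF "0.prems"(3) set_zip_filter(2)[OF l2]])
      (auto simp: set_zip_filter(1)[OF l2])
  note EG = gjoin_arc_iff[OF on(1,2) disj(1)] and EH = gjoin_arc_iff[OF on(3,4) disj(2)]
  have "(x = y) = (x' = y') \<and> ((x, y) \<in> parcs (gjoin G1 G2)) = ((x', y') \<in> parcs (gjoin H1 H2))"
    if Z: "(x, x') \<in> ?Z" "(y, y') \<in> ?Z" for x x' y y'
  proof -
    from side[OF Z(1)] side[OF Z(2)] consider
        "x \<in> pverts G1" "x' \<in> pverts H1" "y \<in> pverts G1" "y' \<in> pverts H1"
      | "x \<in> pverts G1" "x' \<in> pverts H1" "y \<in> pverts G2" "y' \<in> pverts H2"
      | "x \<in> pverts G2" "x' \<in> pverts H2" "y \<in> pverts G1" "y' \<in> pverts H1"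
      | "x \<in> pverts G2" "x' \<in> pverts H2" "y \<in> pverts G2" "y' \<in> pverts H2"
      by blast
    then show ?thesis
    proof cases
      case 1
      then show ?thesis using e1[OF Z] by (simp add: EG EH)
    next
      case 2
      then have "y \<notin> pverts G1" "y' \<notin> pverts H1" using disj by auto
      then show ?thesis using 2 e1[OF Z(1,1)] e2[OF Z(2,2)] by (auto simp: EG EH)
    next
      case 3
      then have "x \<notin> pverts G1" "x' \<notin> pverts H1" using disj by auto
      then show ?thesis using 3 e2[OF Z(1,1)] e1[OF Z(2,2)] by (auto simp: EG EH)
    next
      case 4
      then have "x \<notin> pverts G1" "x' \<notin> pverts H1" "y \<notin> pverts G1" "y' \<notin> pverts H1"
        using disj by auto
      then show ?thesis using 4 e2[OF Z] by (simp add: EG EH)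
    qed
  qed
  then show ?case
    by (subst ef_type_0_eq) (use "0.prems"(1) in \<open>auto dest: list_all2_lengthD\<close>)
next
  case (Suc s)
  let ?f1 = "filter (\<lambda>a. a \<in> pverts G1)" and ?g1 = "filter (\<lambda>a. a \<in> pverts H1)"
  let ?f2 = "filter (\<lambda>a. a \<in> pverts G2)" and ?g2 = "filter (\<lambda>a. a \<in> pverts H2)"
  have fin: "finite (pverts G1)" "finite (pverts G2)" "finite (pverts H1)" "finite (pverts H2)"
    using on by (auto simp: finite_wf_def)
  have V: "pverts (gjoin G1 G2) = pverts G1 \<union> pverts G2" "pverts (gjoin H1 H2) = pverts H1 \<union> pverts H2"
    by (auto simp: gjoin_def)
  note h1 = Suc.prems(2)[unfolded ef_type_Suc_eq[OF fin(1,3)]]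
  note h2 = Suc.prems(3)[unfolded ef_type_Suc_eq[OF fin(2,4)]]
  have s1: "ef_type s (gjoin G1 G2) (a # as) = ef_type s (gjoin H1 H2) (b # bs)"
    if "a \<in> pverts G1" "b \<in> pverts H1" "ef_type s G1 (a # ?f1 as) = ef_type s H1 (b # ?g1 bs)" for a b
  proof -
    have "a \<notin> pverts G2" "b \<notin> pverts H2" using that disj by auto
    then show ?thesis using that Suc.prems(1) h2 by (intro Suc.IH) auto
  qed
  have s2: "ef_type s (gjoin G1 G2) (a # as) = ef_type s (gjoin H1 H2) (b # bs)"
    if "a \<in> pverts G2" "b \<in> pverts H2" "ef_type s G2 (a # ?f2 as) = ef_type s H2 (b # ?g2 bs)" for a b
  proof -
    have "a \<notin> pverts G1" "b \<notin> pverts H1" using that disj by auto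
    then show ?thesis using that Suc.prems(1) h1 by (intro Suc.IH) auto
  qed
  have F: "finite (pverts (gjoin G1 G2))" "finite (pverts (gjoin H1 H2))" using fin V by auto
  show ?case unfolding ef_type_Suc_eq[OF F] V
  proof (intro conjI)
    show "ef_type s (gjoin G1 G2) as = ef_type s (gjoin H1 H2) bs"
      using Suc.prems(1) h1 h2 by (intro Suc.IH) auto
    show "\<forall>a\<in>pverts G1 \<union> pverts G2. \<exists>b\<in>pverts H1 \<union> pverts H2.
        ef_type s (gjoin G1 G2) (a # as) = ef_type s (gjoin H1 H2) (b # bs)"
    proof (intro ballI, elim UnE)
      show "\<exists>b\<in>pverts H1 \<union> pverts H2.
          ef_type s (gjoin G1 G2) (a # as) = ef_type s (gjoin H1 H2) (b # bs)"
        if a: "a \<in> pverts G1" for a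
      proof -
        from h1 a obtain b where "b \<in> pverts H1" "ef_type s G1 (a # ?f1 as) = ef_type s H1 (b # ?g1 bs)"
          by blast
        then show ?thesis using s1[OF a] by blast
      qed
      show "\<exists>b\<in>pverts H1 \<union> pverts H2.
          ef_type s (gjoin G1 G2) (a # as) = ef_type s (gjoin H1 H2) (b # bs)"
        if a: "a \<in> pverts G2" for a
      proof -
        from h2 a obtain b where "b \<in> pverts H2" "ef_type s G2 (a # ?f2 as) = ef_type s H2 (b # ?g2 bs)"
          by blast
        then show ?thesis using s2[OF a] by blast
      qed
    qed
    show "\<forall>b\<in>pverts H1 \<union> pverts H2. \<exists>a\<in>pverts G1 \<union> pverts G2.
        ef_type s (gjoin G1 G2) (a # as) = ef_type s (gjoin H1 H2) (b # bs)"
    proof (intro ballI, elim UnE)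
      show "\<exists>a\<in>pverts G1 \<union> pverts G2.
          ef_type s (gjoin G1 G2) (a # as) = ef_type s (gjoin H1 H2) (b # bs)"
        if b: "b \<in> pverts H1" for b
      proof -
        from h1 b obtain a where "a \<in> pverts G1" "ef_type s G1 (a # ?f1 as) = ef_type s H1 (b # ?g1 bs)"
          by blast
        then show ?thesis using s1[OF _ b] by blast
      qed
      show "\<exists>a\<in>pverts G1 \<union> pverts G2.
          ef_type s (gjoin G1 G2) (a # as) = ef_type s (gjoin H1 H2) (b # bs)"
        if b: "b \<in> pverts H2" for b
      proof -
        from h2 b obtain a where "a \<in> pverts G2" "ef_type s G2 (a # ?f2 as) = ef_type s H2 (b # ?g2 bs)"
          by blast
        then show ?thesis using s2[OF _ b] by blast
      qed
    qed
  qed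
qed

text \<open>
  Erasing all marks is a quantifier-free change of the adjacency relation, so it respects types.
\<close>

lemma ef_type_no_loops:
  assumes "ef_type s L as = ef_type s M bs" "length as = length bs"
    and G: "pverts G = pverts L" "parcs G = {(x, y) \<in> parcs L. x \<noteq> y}"
    and H: "pverts H = pverts M" "parcs H = {(x, y) \<in> parcs M. x \<noteq> y}"
    and fin: "finite (pverts L)" "finite (pverts M)"
  shows "ef_type s G as = ef_type s H bs"
  using assms(1,2)
proof (induction s arbitrary: as bs)
  case 0
  have *: "(x = y) = (x' = y') \<and> ((x, y) \<in> parcs L) = ((x', y') \<in> parcs M)"
    if "(x, x') \<in> set (zip as bs)" "(y, y') \<in> set (zip as bs)" for x x' y y'
    using ef_type_0_D[OF "0.prems" that] .
  show ?case unfolding ef_type_0_eq[OF "0.prems"(2)]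
  proof (intro ballI, clarify)
    fix x x' y y' assume "(x, x') \<in> set (zip as bs)" "(y, y') \<in> set (zip as bs)"
    from *[OF this] show "(x = y) = (x' = y') \<and> ((x, y) \<in> parcs G) = ((x', y') \<in> parcs H)"
      unfolding G H by simp
  qed
next
  case (Suc s)
  have "finite (pverts G)" "finite (pverts H)" using fin G H by auto
  note 1 = ef_type_Suc_eq[OF this] and 2 = ef_type_Suc_eq[OF fin]
  have "ef_type s G (a # as) = ef_type s H (b # bs)"
    if "ef_type s L (a # as) = ef_type s M (b # bs)" for a b
    using Suc.IH[OF that] Suc.prems(2) by simp
  then show ?case
    using Suc.prems Suc.IH[of as bs] unfolding 1 2 G(1) H(1) by (meson)
qed

section \<open>Graphs cut into closed parts\<close>

definition closed_in :: "'a pair_pre_digraph \<Rightarrow> 'a set \<Rightarrow> bool" where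
  "closed_in G W \<longleftrightarrow> (\<forall>(x, y) \<in> parcs G. x \<in> W \<longleftrightarrow> y \<in> W)"

lemma induced_on_simps [simp]:
  "pverts (induced_on G W) = pverts G \<inter> W"
  "parcs (induced_on G W) = {(u, v) \<in> parcs G. u \<in> W \<and> v \<in> W}"
  by (auto simp: induced_on_def)

lemma induced_on_induced_on [simp]: "induced_on (induced_on G W) U = induced_on G (W \<inter> U)"
  by (auto simp: induced_on_def)

lemma pair_graph_iff:
  "pair_graph G \<longleftrightarrow> finite (pverts G) \<and> parcs G \<subseteq> pverts G \<times> pverts G \<and> sym (parcs G) \<and> irrefl (parcs G)"
proof
  assume "pair_graph G"
  then interpret pair_graph G .
  show "finite (pverts G) \<and> parcs G \<subseteq> pverts G \<times> pverts G \<and> sym (parcs G) \<and> irrefl (parcs G)"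
    by (auto simp: sym_def irrefl_def pair_finite_verts dest: in_arcsD1 in_arcsD2 arcs_symmetric no_loops')
next
  assume *: "finite (pverts G) \<and> parcs G \<subseteq> pverts G \<times> pverts G \<and> sym (parcs G) \<and> irrefl (parcs G)"
  then have "finite (parcs G)" by (meson finite_SigmaI finite_subset)
  with * show "pair_graph G"
    by unfold_locales (auto simp: symmetric_def irrefl_def)
qed

lemma pair_graph_induced_on: "pair_graph G \<Longrightarrow> pair_graph (induced_on G W)"
  by (auto simp: pair_graph_iff sym_def irrefl_def)

lemma pair_graph_finite_wf: "pair_graph G \<Longrightarrow> finite_wf G"
  by (simp add: pair_graph_iff finite_wf_def)

lemma gjoin_closed:
  assumes "pair_graph G" "closed_in G W"
  shows "gjoin (induced_on G W) (induced_on G (- W)) = G"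
  using assms by (intro pair_pre_digraph.equality)
    (auto simp: gjoin_def pair_graph_iff irrefl_def closed_in_def)

lemma ef_type_split:
  assumes G: "pair_graph G" "closed_in G W" and H: "pair_graph H" "closed_in H U"
    and as: "list_all2 (\<lambda>a b. a \<in> pverts G \<inter> W \<and> b \<in> pverts H \<inter> U) as bs"
    and "ef_type s (induced_on G W) as = ef_type s (induced_on H U) bs"
    and "ef_type s (induced_on G (- W)) [] = ef_type s (induced_on H (- U)) []"
  shows "ef_type s G as = ef_type s H bs"
proof -
  have "set as \<subseteq> pverts G \<inter> W" "set bs \<subseteq> pverts H \<inter> U"
    using as by (auto simp: list_all2_conv_all_nth in_set_conv_nth)
  then have f: "filter (\<lambda>a. a \<in> pverts (induced_on G W)) as = as"
    "filter (\<lambda>a. a \<in> pverts (induced_on H U)) bs = bs"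
    "filter (\<lambda>a. a \<in> pverts (induced_on G (- W))) as = []"
    "filter (\<lambda>a. a \<in> pverts (induced_on H (- U))) bs = []"
    by (auto simp: filter_id_conv filter_empty_conv)
  have "ef_type s (gjoin (induced_on G W) (induced_on G (- W))) as
      = ef_type s (gjoin (induced_on H U) (induced_on H (- U))) bs"
  proof (rule ef_type_gjoin)
    show "list_all2 (\<lambda>a b. a \<in> pverts (induced_on G W) \<and> b \<in> pverts (induced_on H U) \<or>
        a \<in> pverts (induced_on G (- W)) \<and> b \<in> pverts (induced_on H (- U))) as bs"
      using as by (rule list_all2_mono) auto
  qed (use assms in \<open>auto simp only: f intro!: pair_graph_finite_wf pair_graph_induced_on\<close>, auto)
  then show ?thesis by (simp add: gjoin_closed G H)
qed

definition closed_partition :: "'a pair_pre_digraph \<Rightarrow> 'a set set \<Rightarrow> bool" where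
  "closed_partition G P \<longleftrightarrow> finite P \<and> disjoint P \<and> \<Union>P = pverts G \<and> (\<forall>C\<in>P. closed_in G C)"

lemma closed_in_Union: "(\<And>C. C \<in> P \<Longrightarrow> closed_in G C) \<Longrightarrow> closed_in G (\<Union>P)"
  unfolding closed_in_def case_prod_beta Union_iff by blast

lemma closed_in_induced_on: "closed_in G C \<Longrightarrow> closed_in (induced_on G W) C"
  by (auto simp: closed_in_def)

lemma closed_partition_restrict:
  assumes "closed_partition G P" "Q \<subseteq> P"
  shows "closed_partition (induced_on G (\<Union>Q)) Q"
    and "closed_partition (induced_on G (- \<Union>Q)) (P - Q)"
    and "\<And>C. C \<in> Q \<Longrightarrow> induced_on (induced_on G (\<Union>Q)) C = induced_on G C"
    and "\<And>C. C \<in> P - Q \<Longrightarrow> induced_on (induced_on G (- \<Union>Q)) C = induced_on G C"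
    and "closed_in G (\<Union>Q)"
proof -
  have P: "finite P" "disjoint P" "\<Union>P = pverts G" "\<And>C. C \<in> P \<Longrightarrow> closed_in G C"
    using assms by (auto simp: closed_partition_def)
  have d: "C \<inter> \<Union>Q = {}" if "C \<in> P - Q" for C
    using P(2) that assms(2) by (fastforce simp: disjoint_def)
  show "closed_partition (induced_on G (\<Union>Q)) Q"
    unfolding closed_partition_def
    using P assms(2) by (auto simp: closed_in_induced_on intro: pairwise_subset finite_subset)
  show "closed_partition (induced_on G (- \<Union>Q)) (P - Q)"
    unfolding closed_partition_def
  proof (intro conjI ballI)
    show "disjoint (P - Q)" using P(2) by (rule pairwise_subset) auto
    have "\<Union>(P - Q) = \<Union>P - \<Union>Q" using d assms(2) by blast
    then show "\<Union>(P - Q) = pverts (induced_on G (- \<Union>Q))" using P(3) by auto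
  qed (use P in \<open>auto simp: closed_in_induced_on\<close>)
  show "induced_on (induced_on G (\<Union>Q)) C = induced_on G C" if "C \<in> Q" for C
    using that by (auto intro!: arg_cong[of _ _ "induced_on G"])
  show "induced_on (induced_on G (- \<Union>Q)) C = induced_on G C" if "C \<in> P - Q" for C
    using d[OF that] by (auto intro!: arg_cong[of _ _ "induced_on G"])
  show "closed_in G (\<Union>Q)"
    using P(4) assms(2) by (auto intro: closed_in_Union)
qed

text \<open>
  With \<open>s\<close> rounds left and at least \<open>s\<close> indistinguishable pieces on either side, Duplicator answers in
  any piece; afterwards \<open>s - 1\<close> rounds are left and at least \<open>s - 1\<close> pieces are untouched.
\<close>

lemma ef_type_copies:
  assumes "pair_graph G" "closed_partition G P" "pair_graph H" "closed_partition H Q"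
    and "\<And>C. C \<in> P \<Longrightarrow> ef_type s (induced_on G C) [] = t"
    and "\<And>C. C \<in> Q \<Longrightarrow> ef_type s (induced_on H C) [] = t"
    and "s \<le> card P" "s \<le> card Q"
  shows "ef_type s G [] = ef_type s H []"
  using assms
proof (induction s arbitrary: G P H Q t)
  case 0
  then show ?case by (simp add: ef_type_0_eq)
next
  case (Suc s)
  obtain t' where t': "\<And>C. C \<in> P \<Longrightarrow> ef_type s (induced_on G C) [] = t'"
    "\<And>C. C \<in> Q \<Longrightarrow> ef_type s (induced_on H C) [] = t'"
    using Suc.prems(5,6) ef_type_downward[of s] unfolding ef_type.simps
    by (metis prod_encode_inverse fst_conv)
  have fin: "finite (pverts G)" "finite (pverts H)" using Suc.prems(1,3) by (auto simp: pair_graph_iff)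
  have P: "finite P" "\<Union>P = pverts G" and Q: "finite Q" "\<Union>Q = pverts H"
    using Suc.prems(2,4) by (auto simp: closed_partition_def)
  have "P \<noteq> {}" "Q \<noteq> {}" using Suc.prems(7,8) by auto
  have move: "ef_type s G [a] = ef_type s H [b]"
    if C: "C \<in> P" "D \<in> Q" "a \<in> C" "b \<in> D"
      "ef_type s (induced_on G C) [a] = ef_type s (induced_on H D) [b]" for C D a b
  proof (rule ef_type_split[OF Suc.prems(1) _ Suc.prems(3)])
    note p = closed_partition_restrict[OF Suc.prems(2), of "{C}", simplified, OF C(1)]
    note q = closed_partition_restrict[OF Suc.prems(4), of "{D}", simplified, OF C(2)]
    show "closed_in G C" "closed_in H D" using p q by auto
    show "list_all2 (\<lambda>a b. a \<in> pverts G \<inter> C \<and> b \<in> pverts H \<inter> D) [a] [b]"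
      using C P Q by auto
    show "ef_type s (induced_on G C) [a] = ef_type s (induced_on H D) [b]" by fact
    show "ef_type s (induced_on G (- C)) [] = ef_type s (induced_on H (- D)) []"
    proof (rule Suc.IH)
      show "closed_partition (induced_on G (- C)) (P - {C})"
        "closed_partition (induced_on H (- D)) (Q - {D})" using p q by auto
      show "ef_type s (induced_on (induced_on G (- C)) C') [] = t'" if "C' \<in> P - {C}" for C'
        using p(4)[of C'] that t' by simp
      show "ef_type s (induced_on (induced_on H (- D)) C') [] = t'" if "C' \<in> Q - {D}" for C'
        using q(4)[of C'] that t' by simp
      show "s \<le> card (P - {C})" "s \<le> card (Q - {D})"
        using Suc.prems(7,8) C(1,2) P Q by auto
    qed (use Suc.prems in \<open>auto intro: pair_graph_induced_on\<close>)
  qed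
  have piece: "ef_type (Suc s) (induced_on G C) [] = ef_type (Suc s) (induced_on H D) []"
    if "C \<in> P" "D \<in> Q" for C D
    using Suc.prems(5,6) that by metis
  have finI: "finite (pverts (induced_on G C))" "finite (pverts (induced_on H D))" for C D
    using fin by auto
  show ?case unfolding ef_type_Suc_eq[OF fin]
  proof (intro conjI ballI)
    show "ef_type s G [] = ef_type s H []"
      using Suc.prems t' by (intro Suc.IH[of G P H Q t']) auto
    show "\<exists>b\<in>pverts H. ef_type s G [a] = ef_type s H [b]" if a: "a \<in> pverts G" for a
    proof -
      from a P(2) \<open>Q \<noteq> {}\<close> obtain C D where C: "C \<in> P" "D \<in> Q" "a \<in> C"
        by (metis UnionE all_not_in_conv)
      then obtain b where "b \<in> pverts (induced_on H D)"
          "ef_type s (induced_on G C) [a] = ef_type s (induced_on H D) [b]"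
        using piece[OF C(1,2)] a unfolding ef_type_Suc_eq[OF finI] by auto
      with move[OF C] show ?thesis by auto
    qed
    show "\<exists>a\<in>pverts G. ef_type s G [a] = ef_type s H [b]" if b: "b \<in> pverts H" for b
    proof -
      from b Q(2) \<open>P \<noteq> {}\<close> obtain C D where C: "C \<in> P" "D \<in> Q" "b \<in> D"
        by (metis UnionE all_not_in_conv)
      then obtain a where "a \<in> pverts (induced_on G C)"
          "ef_type s (induced_on G C) [a] = ef_type s (induced_on H D) [b]"
        using piece[OF C(1,2)] b unfolding ef_type_Suc_eq[OF finI] by auto
      with move[OF C(1,2) _ C(3)] show ?thesis by auto
    qed
  qed
qed

text \<open>
  Pieces of the same type are collected into blocks, the blocks are compared by the previous lemma,
  and blocks of different types are put together one after the other.
\<close>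

lemma ef_type_closed_partition:
  assumes "finite X"
    and "pair_graph G" "closed_partition G P" "pair_graph H" "closed_partition H Q"
    and "\<And>C. C \<in> P \<Longrightarrow> ef_type s (induced_on G C) [] \<in> X"
    and "\<And>C. C \<in> Q \<Longrightarrow> ef_type s (induced_on H C) [] \<in> X"
    and "\<And>t. t \<in> X \<Longrightarrow> s \<le> card {C \<in> P. ef_type s (induced_on G C) [] = t}"
    and "\<And>t. t \<in> X \<Longrightarrow> s \<le> card {C \<in> Q. ef_type s (induced_on H C) [] = t}"
  shows "ef_type s G [] = ef_type s H []"
  using assms
proof (induction X arbitrary: G P H Q)
  case empty
  then have "P = {}" "Q = {}" by auto
  then have "pverts G = {}" "pverts H = {}" using empty.prems by (auto simp: closed_partition_def)
  then show ?case by (induction s) (simp_all add: ef_type.simps)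
next
  case (insert t X)
  define P1 where "P1 = {C \<in> P. ef_type s (induced_on G C) [] = t}"
  define Q1 where "Q1 = {C \<in> Q. ef_type s (induced_on H C) [] = t}"
  have "P1 \<subseteq> P" "Q1 \<subseteq> Q" by (auto simp: P1_def Q1_def)
  note p = closed_partition_restrict[OF insert.prems(2) \<open>P1 \<subseteq> P\<close>]
  note q = closed_partition_restrict[OF insert.prems(4) \<open>Q1 \<subseteq> Q\<close>]
  show ?case
  proof (rule ef_type_split[OF insert.prems(1) p(5) insert.prems(3) q(5)])
    show "ef_type s (induced_on G (\<Union> P1)) [] = ef_type s (induced_on H (\<Union> Q1)) []"
    proof (rule ef_type_copies[OF _ p(1) _ q(1)])
      show "ef_type s (induced_on (induced_on G (\<Union> P1)) C) [] = t" if "C \<in> P1" for C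
        unfolding p(3)[OF that] using that by (simp add: P1_def)
      show "ef_type s (induced_on (induced_on H (\<Union> Q1)) C) [] = t" if "C \<in> Q1" for C
        unfolding q(3)[OF that] using that by (simp add: Q1_def)
      show "s \<le> card P1" "s \<le> card Q1"
        using insert.prems(7,8)[of t] by (auto simp: P1_def Q1_def)
    qed (use insert.prems in \<open>auto intro: pair_graph_induced_on\<close>)
    show "ef_type s (induced_on G (- \<Union> P1)) [] = ef_type s (induced_on H (- \<Union> Q1)) []"
    proof (rule insert.IH[OF _ p(2) _ q(2)])
      show "ef_type s (induced_on (induced_on G (- \<Union> P1)) C) [] \<in> X" if "C \<in> P - P1" for C
        unfolding p(4)[OF that] using that insert.prems(5)[of C] by (auto simp: P1_def)
      show "ef_type s (induced_on (induced_on H (- \<Union> Q1)) C) [] \<in> X" if "C \<in> Q - Q1" for C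
        unfolding q(4)[OF that] using that insert.prems(6)[of C] by (auto simp: Q1_def)
      show "s \<le> card {C \<in> P - P1. ef_type s (induced_on (induced_on G (- \<Union> P1)) C) [] = u}"
        if "u \<in> X" for u
      proof -
        have "u \<noteq> t" using that insert.hyps by auto
        then have "{C \<in> P - P1. ef_type s (induced_on (induced_on G (- \<Union> P1)) C) [] = u}
            = {C \<in> P. ef_type s (induced_on G C) [] = u}"
          using p(4) by (auto simp: P1_def simp del: induced_on_induced_on)
        then show ?thesis using insert.prems(7)[of u] that by simp
      qed
      show "s \<le> card {C \<in> Q - Q1. ef_type s (induced_on (induced_on H (- \<Union> Q1)) C) [] = u}"
        if "u \<in> X" for u
      proof -
        have "u \<noteq> t" using that insert.hyps by auto
        then have "{C \<in> Q - Q1. ef_type s (induced_on (induced_on H (- \<Union> Q1)) C) [] = u}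
            = {C \<in> Q. ef_type s (induced_on H C) [] = u}"
          using q(4) by (auto simp: Q1_def simp del: induced_on_induced_on)
        then show ?thesis using insert.prems(8)[of u] that by simp
      qed
    qed (use insert.prems in \<open>auto intro: pair_graph_induced_on\<close>)
  qed simp
qed

section \<open>Forests and trees\<close>

text \<open>
  A cycle given by its vertices, which is what a union bound over possible cycles needs.
\<close>

definition cyclic_list :: "'a rel \<Rightarrow> 'a list \<Rightarrow> bool" where
  "cyclic_list E vs \<longleftrightarrow> distinct vs \<and> 3 \<le> length vs \<and>
     (\<forall>i. Suc i < length vs \<longrightarrow> (vs ! i, vs ! Suc i) \<in> E) \<and> (last vs, hd vs) \<in> E"

definition bridge_in :: "'a rel \<Rightarrow> 'a \<times> 'a \<Rightarrow> bool" where
  "bridge_in E e \<longleftrightarrow> e \<notin> (E - {e, prod.swap e})\<^sup>*"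

lemma cycle_imp_cyclic_list:
  assumes "pair_graph G" "pre_digraph.cycle (with_proj G) p" "3 \<le> length p"
  shows "\<exists>vs. cyclic_list (parcs G) vs \<and> set vs \<subseteq> pverts G"
proof -
  interpret pair_graph G by fact
  from assms(2) obtain u where u: "awalk u p u" "distinct (tl (pawalk_verts u p))"
    by (auto simp: cycle_def)
  have p: "set p \<subseteq> parcs G" "pcas u p u" "p \<noteq> []" using u assms(3) by (auto simp: awalk_def)
  have step: "snd (q ! i) = fst (q ! Suc i)" if "pcas x q y" "Suc i < length q" for q i and x y :: 'a
    using that
  proof (induction q arbitrary: x i)
    case (Cons e q)
    show ?case
    proof (cases i)
      case 0
      with Cons.prems show ?thesis by (cases q) auto
    next
      case (Suc j)
      with Cons show ?thesis by auto
    qed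
  qed simp
  have ends: "q \<noteq> [] \<Longrightarrow> pcas x q y \<Longrightarrow> fst (hd q) = x \<and> snd (last q) = y" for q and x y :: 'a
    by (induction q arbitrary: x) auto
  have verts: "pawalk_verts u p = map fst p @ [snd (last p)]"
    using awalk_verts_conv[of u p] p(3) by simp
  have "distinct (map fst p)"
    using u(2) ends[OF p(3,2)] p(3) unfolding verts by (cases p) auto
  moreover have "(map fst p ! i, map fst p ! Suc i) \<in> parcs G" if "Suc i < length p" for i
  proof -
    have "p ! i \<in> parcs G" using p(1) that by auto
    then show ?thesis using step[OF p(2) that] that by (metis Suc_lessD nth_map prod.collapse)
  qed
  moreover have "(last (map fst p), hd (map fst p)) \<in> parcs G"
  proof -
    have "last p \<in> parcs G" using p(1,3) by auto
    then show ?thesis using ends[OF p(3,2)] p(3) by (metis hd_map last_map prod.collapse)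
  qed
  moreover have "set (map fst p) \<subseteq> pverts G" using p(1) in_arcsD1 by fastforce
  ultimately show ?thesis using assms(3)
    by (intro exI[of _ "map fst p"]) (auto simp: cyclic_list_def)
qed

lemma cyclic_list_not_bridge:
  assumes "cyclic_list E vs"
  shows "\<not> bridge_in E (hd vs, last vs)"
proof -
  let ?n = "length vs - 1"
  let ?D = "{(hd vs, last vs), (last vs, hd vs)}"
  have vs: "distinct vs" "3 \<le> length vs" "\<And>i. Suc i < length vs \<Longrightarrow> (vs ! i, vs ! Suc i) \<in> E"
    using assms by (auto simp: cyclic_list_def)
  have "vs \<noteq> []" using vs by auto
  then have hl: "hd vs = vs ! 0" "last vs = vs ! ?n" by (auto simp: hd_conv_nth last_conv_nth)
  have "(vs ! 0, vs ! i) \<in> (E - ?D)\<^sup>*" if "i \<le> ?n" for i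
    using that
  proof (induction i)
    case (Suc i)
    then have i: "Suc i < length vs" using vs(2) by auto
    have "vs ! i \<noteq> vs ! ?n" using i nth_eq_iff_index_eq[OF vs(1), of i ?n] by simp
    moreover have "\<not> (vs ! i = vs ! 0 \<and> vs ! Suc i = vs ! ?n)"
    proof
      assume *: "vs ! i = vs ! 0 \<and> vs ! Suc i = vs ! ?n"
      have "i < length vs" "0 < length vs" "?n < length vs" using i by auto
      then have "i = 0" "Suc i = ?n" using * i nth_eq_iff_index_eq[OF vs(1)] by blast+
      then show False using vs(2) by simp
    qed
    ultimately have "(vs ! i, vs ! Suc i) \<notin> ?D" unfolding hl by blast
    then show ?case using Suc vs(3)[OF i] by (auto intro: rtrancl_into_rtrancl)
  qed simp
  from this[of ?n] show ?thesis by (simp add: hl bridge_in_def)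
qed

lemma not_bridge_imp_cycle:
  assumes "pair_graph G" "(u, v) \<in> parcs G" "\<not> bridge_in (parcs G) (u, v)"
  shows "\<exists>p. pre_digraph.cycle (with_proj G) p \<and> 3 \<le> length p"
proof -
  interpret pair_graph G by fact
  define R where "R = parcs G - {(u, v), (v, u)}"
  define r where "r = (\<lambda>x y. (x, y) \<in> R)"
  from assms(3) have "(u, v) \<in> R\<^sup>*" by (simp add: bridge_in_def R_def)
  then have "r\<^sup>*\<^sup>* u v" by (simp add: r_def rtranclp_rtrancl_eq)
  then obtain xs0 where "rtrancl_path r u xs0 v" by (auto simp: rtranclp_eq_rtrancl_path)
  then obtain xs where xs: "rtrancl_path r u xs v" "distinct (u # xs)"
    by (rule rtrancl_path_distinct)
  have arcs: "\<exists>p. pcas x p y \<and> set p \<subseteq> parcs G \<and> pawalk_verts x p = x # ys" 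
    if "rtrancl_path r x ys y" for x y ys
    using that
  proof induction
    case (base x)
    show ?case by (intro exI[of _ "[]"]) simp
  next
    case (step x y ys z)
    then obtain p where "pcas y p z \<and> set p \<subseteq> parcs G \<and> pawalk_verts y p = y # ys" by blast
    then show ?case using step by (intro exI[of _ "(x, y) # p"]) (auto simp: r_def R_def)
  qed
  from arcs[OF xs(1)] obtain p where p: "pcas u p v" "set p \<subseteq> parcs G" "pawalk_verts u p = u # xs"
    by blast
  have "u \<noteq> v" using assms(2) no_loops' by blast
  have len: "length p = length xs"
    using arg_cong[OF p(3), of length] length_awalk_verts[of u p] by simp
  have "2 \<le> length xs"
  proof (rule ccontr)
    assume "\<not> 2 \<le> length xs"
    then consider "xs = []" | y where "xs = [y]" by (cases xs; cases "tl xs") auto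
    then show False
    proof cases
      case 1
      with xs(1) \<open>u \<noteq> v\<close> show False by (auto elim: rtrancl_path.cases)
    next
      case 2
      with xs(1) have "r u v" by (auto elim: rtrancl_path.cases)
      then show False by (simp add: r_def R_def)
    qed
  qed
  let ?p = "p @ [(v, u)]"
  have "last (pawalk_verts u p) = v" using awlast_if_cas[OF p(1)] .
  have "pcas x (es @ [(y, z)]) z" if "pcas x es y" for es and x y z :: 'a
    using that by (induction es arbitrary: x) auto
  from this[OF p(1)] have "pcas u ?p u" .
  moreover have "set ?p \<subseteq> parcs G" using p(2) assms(2) arcs_symmetric by auto
  moreover have "u \<in> pverts G" using assms(2) in_arcsD1 by blast
  ultimately have "awalk u ?p u" by (simp add: awalk_def)
  moreover have "pawalk_verts u ?p = u # xs @ [u]"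
  proof -
    have "pawalk_verts u p = map fst p @ [snd (last p)]"
      using awalk_verts_conv[of u p] len \<open>2 \<le> length xs\<close> by auto
    moreover have "snd (last p) = v"
      using \<open>last (pawalk_verts u p) = v\<close> calculation by simp
    ultimately have "u # xs = map fst p @ [v]" using p(3) by simp
    then show ?thesis using awalk_verts_conv[of u ?p] by simp
  qed
  ultimately have "cycle ?p" using xs(2) by (auto simp: cycle_def)
  then show ?thesis using len \<open>2 \<le> length xs\<close> by (intro exI[of _ ?p]) auto
qed

text \<open>
  Bridges are easier to handle than cycles in inductions over trees: cutting a bridge separates a
  tree, and a graph assembled along a bridge keeps the bridges of its parts.
\<close>

lemma is_forest_iff_bridges:
  "is_forest G \<longleftrightarrow> pair_graph G \<and> (\<forall>e\<in>parcs G. bridge_in (parcs G) e)"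
proof (cases "pair_graph G")
  case True
  have "\<exists>e\<in>parcs G. \<not> bridge_in (parcs G) e"
    if "pre_digraph.cycle (with_proj G) p" "3 \<le> length p" for p
  proof -
    from cycle_imp_cyclic_list[OF True that] obtain vs where vs: "cyclic_list (parcs G) vs" by blast
    then have "(hd vs, last vs) \<in> parcs G"
      using True by (auto simp: cyclic_list_def pair_graph_iff sym_def)
    with cyclic_list_not_bridge[OF vs] show ?thesis by blast
  qed
  moreover have "\<exists>p. pre_digraph.cycle (with_proj G) p \<and> 3 \<le> length p"
    if "e \<in> parcs G" "\<not> bridge_in (parcs G) e" for e
    using not_bridge_imp_cycle[OF True, of "fst e" "snd e"] that by simp
  ultimately show ?thesis unfolding is_forest_def using True by blast
qed (simp add: is_forest_def)

lemma not_forest_imp_cyclic_list: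
  assumes "pair_graph G" "\<not> is_forest G"
  obtains vs where "cyclic_list (parcs G) vs" "set vs \<subseteq> pverts G"
proof -
  from assms obtain p where "pre_digraph.cycle (with_proj G) p" "3 \<le> length p"
    by (auto simp: is_forest_def)
  from cycle_imp_cyclic_list[OF assms(1) this] that show thesis by blast
qed

lemma bridge_in_antimono: "E \<subseteq> F \<Longrightarrow> bridge_in F e \<Longrightarrow> bridge_in E e"
  unfolding bridge_in_def using rtrancl_mono[of "E - {e, prod.swap e}" "F - {e, prod.swap e}"] by blast

lemma is_forest_induced_on: "is_forest G \<Longrightarrow> is_forest (induced_on G W)"
  unfolding is_forest_iff_bridges
  by (auto intro!: pair_graph_induced_on intro: bridge_in_antimono[of _ "parcs G"])

lemma reachable_in_verts:
  assumes "finite_wf G" "(u, v) \<in> (parcs G)\<^sup>*" "u \<in> pverts G"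
  shows "v \<in> pverts G"
  using assms(2,3) by (induction rule: rtrancl_induct) (use assms(1) in \<open>auto simp: finite_wf_def\<close>)

lemma reachable_iff_rtrancl:
  assumes "finite_wf G"
  shows "u \<rightarrow>\<^sup>*\<^bsub>with_proj G\<^esub> v \<longleftrightarrow> u \<in> pverts G \<and> (u, v) \<in> (parcs G)\<^sup>*"
proof
  assume "u \<rightarrow>\<^sup>*\<^bsub>with_proj G\<^esub> v"
  then show "u \<in> pverts G \<and> (u, v) \<in> (parcs G)\<^sup>*"
    by (auto simp: reachable_def dest: rtrancl_on_rtranclI in_rtrancl_on_in_F)
next
  assume "u \<in> pverts G \<and> (u, v) \<in> (parcs G)\<^sup>*"
  then show "u \<rightarrow>\<^sup>*\<^bsub>with_proj G\<^esub> v"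
    using reachable_in_verts[OF assms] assms unfolding reachable_def
    by (auto intro!: rtrancl_consistent_rtrancl_on simp: finite_wf_def)
qed

lemma is_tree_iff:
  "is_tree G \<longleftrightarrow> is_forest G \<and> pverts G \<noteq> {} \<and> (\<forall>u\<in>pverts G. \<forall>v\<in>pverts G. (u, v) \<in> (parcs G)\<^sup>*)"
proof (cases "pair_graph G")
  case True
  then have "sym (parcs G)" by (simp add: pair_graph_iff)
  then have "mk_symmetric (with_proj G) = G"
    by (intro pair_pre_digraph.equality) (auto simp: mk_symmetric_def sym_def)
  then show ?thesis
    using reachable_iff_rtrancl[OF pair_graph_finite_wf[OF True]]
    by (auto simp: is_tree_def connected_def strongly_connected_def)
qed (simp add: is_tree_def is_forest_def)

lemma is_treeI:
  assumes "is_forest G" "r \<in> pverts G" "\<And>v. v \<in> pverts G \<Longrightarrow> (r, v) \<in> (parcs G)\<^sup>*"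
  shows "is_tree G"
proof -
  have "sym ((parcs G)\<^sup>*)"
    using assms(1) by (auto simp: is_forest_def pair_graph_iff intro: sym_rtrancl)
  then have "(u, r) \<in> (parcs G)\<^sup>*" if "u \<in> pverts G" for u
    using assms(3)[OF that] by (auto dest: symD)
  then have "(u, v) \<in> (parcs G)\<^sup>*" if "u \<in> pverts G" "v \<in> pverts G" for u v
    using assms(3) that rtrancl_trans by metis
  then show ?thesis using assms(1,2) unfolding is_tree_iff by blast
qed

section \<open>Components\<close>

lemma component_of_eq:
  "finite_wf G \<Longrightarrow> v \<in> pverts G \<Longrightarrow> component_of G v = (parcs G)\<^sup>* `` {v}"
  by (auto simp: component_of_def reachable_iff_rtrancl)

lemma component_of_eq_iff:
  assumes "pair_graph G" "u \<in> pverts G" "v \<in> pverts G"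
  shows "component_of G u = component_of G v \<longleftrightarrow> (u, v) \<in> (parcs G)\<^sup>*"
proof -
  note c = component_of_eq[OF pair_graph_finite_wf[OF assms(1)]]
  have s: "sym ((parcs G)\<^sup>*)" using assms(1) by (auto simp: pair_graph_iff intro: sym_rtrancl)
  show ?thesis
  proof
    assume "component_of G u = component_of G v"
    then show "(u, v) \<in> (parcs G)\<^sup>*" using c assms(2,3) by auto
  next
    assume uv: "(u, v) \<in> (parcs G)\<^sup>*"
    with s have "(v, u) \<in> (parcs G)\<^sup>*" by (rule symD)
    with uv show "component_of G u = component_of G v"
      using c assms(2,3) by (auto intro: rtrancl_trans)
  qed
qed

lemma in_component_of: "finite_wf G \<Longrightarrow> v \<in> pverts G \<Longrightarrow> v \<in> component_of G v"
  by (simp add: component_of_eq)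

lemma component_of_subset: "finite_wf G \<Longrightarrow> v \<in> pverts G \<Longrightarrow> component_of G v \<subseteq> pverts G"
  by (auto simp: component_of_eq dest: reachable_in_verts)

lemma closed_in_component_of:
  assumes "pair_graph G" "v \<in> pverts G"
  shows "closed_in G (component_of G v)"
proof -
  have "sym (parcs G)" using assms(1) by (simp add: pair_graph_iff)
  then show ?thesis
    using assms component_of_eq[OF pair_graph_finite_wf[OF assms(1)] assms(2)]
    by (auto simp: closed_in_def dest: symD intro: rtrancl_into_rtrancl)
qed

lemma closed_partition_components:
  assumes "pair_graph G"
  shows "closed_partition G (components_of G)"
  unfolding closed_partition_def
proof (intro conjI)
  have on: "finite_wf G" using assms by (rule pair_graph_finite_wf)
  show "finite (components_of G)" using on by (simp add: components_of_def finite_wf_def)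
  show "\<Union>(components_of G) = pverts G"
    using in_component_of[OF on] component_of_subset[OF on] by (auto simp: components_of_def)
  show "\<forall>C\<in>components_of G. closed_in G C"
    using closed_in_component_of[OF assms] by (auto simp: components_of_def)
  show "disjoint (components_of G)"
  proof (rule disjointI)
    fix C D assume CD: "C \<in> components_of G" "D \<in> components_of G" "C \<noteq> D"
    then obtain u v where uv: "u \<in> pverts G" "v \<in> pverts G" "C = component_of G u" "D = component_of G v"
      by (auto simp: components_of_def)
    show "C \<inter> D = {}"
    proof (rule ccontr)
      assume "C \<inter> D \<noteq> {}"
      then obtain w where w: "w \<in> C" "w \<in> D" by blast
      then have "w \<in> pverts G" "(u, w) \<in> (parcs G)\<^sup>*" "(v, w) \<in> (parcs G)\<^sup>*"
        using uv component_of_subset[OF on] component_of_eq[OF on] by auto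
      then have "component_of G u = component_of G w" "component_of G v = component_of G w"
        using component_of_eq_iff[OF assms] uv by auto
      then show False using CD uv by auto
    qed
  qed
qed

lemma rtrancl_restrict_closed:
  assumes "closed_in G W" "(u, v) \<in> (parcs G)\<^sup>*" "u \<in> W"
  shows "(u, v) \<in> (parcs (induced_on G W))\<^sup>* \<and> v \<in> W"
  using assms(2,3)
proof (induction rule: rtrancl_induct)
  case (step y z)
  then have "z \<in> W" "y \<in> W" using assms(1) by (auto simp: closed_in_def)
  then have "(y, z) \<in> parcs (induced_on G W)" using step by auto
  then show ?case using step \<open>z \<in> W\<close> by (auto intro: rtrancl_into_rtrancl)
qed simp

lemma component_of_induced_on:
  assumes "finite_wf G" "closed_in G W" "v \<in> pverts G" "v \<in> W"
  shows "component_of (induced_on G W) v = component_of G v"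
proof -
  have "finite_wf (induced_on G W)" using assms(1) by (auto simp: finite_wf_def)
  moreover have "(parcs (induced_on G W))\<^sup>* \<subseteq> (parcs G)\<^sup>*" by (rule rtrancl_mono) auto
  ultimately show ?thesis
    using rtrancl_restrict_closed[OF assms(2) _ assms(4)] assms by (auto simp: component_of_eq)
qed

lemma is_tree_component:
  assumes "is_forest G" "C \<in> components_of G"
  shows "is_tree (induced_on G C)"
proof -
  have G: "pair_graph G" using assms(1) by (simp add: is_forest_def)
  from assms(2) obtain v where v: "v \<in> pverts G" "C = component_of G v" by (auto simp: components_of_def)
  note on = pair_graph_finite_wf[OF G]
  show ?thesis
  proof (rule is_treeI[of _ v])
    show "is_forest (induced_on G C)" using assms(1) by (rule is_forest_induced_on)
    show "v \<in> pverts (induced_on G C)" using in_component_of[OF on] v by simp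
    show "(v, w) \<in> (parcs (induced_on G C))\<^sup>*" if "w \<in> pverts (induced_on G C)" for w
      using that v component_of_eq[OF on v(1)] in_component_of[OF on v(1)]
        rtrancl_restrict_closed[OF closed_in_component_of[OF G v(1)], of v w] by auto
  qed
qed

lemma component_characterization:
  assumes "pair_graph G" "closed_in G C" "is_tree (induced_on G C)" "C \<subseteq> pverts G"
  shows "C \<in> components_of G"
proof -
  note on = pair_graph_finite_wf[OF assms(1)]
  from assms(3,4) obtain v where v: "v \<in> C" "v \<in> pverts G" by (auto simp: is_tree_iff)
  have "component_of (induced_on G C) v = C"
  proof -
    have "finite_wf (induced_on G C)" using on by (auto simp: finite_wf_def)
    moreover have "v \<in> pverts (induced_on G C)" using v by auto
    ultimately show ?thesis
      using assms(3,4) component_of_subset[of "induced_on G C" v] v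
      by (auto simp: component_of_eq is_tree_iff)
  qed
  then have "component_of G v = C" using component_of_induced_on[OF on assms(2) v(2,1)] by simp
  then show ?thesis using v by (auto simp: components_of_def)
qed

lemma prune_props:
  assumes "pair_graph G"
  shows "pair_graph (prune m G)"
    and "components_of (prune m G) = {C \<in> components_of G. m \<le> card C}"
    and "\<And>C. C \<in> components_of (prune m G) \<Longrightarrow> induced_on (prune m G) C = induced_on G C"
proof -
  define W where "W = {v \<in> pverts G. m \<le> card (component_of G v)}"
  have prune: "prune m G = induced_on G W" by (simp add: prune_def W_def)
  note on = pair_graph_finite_wf[OF assms]
  show "pair_graph (prune m G)" unfolding prune by (rule pair_graph_induced_on[OF assms])
  have cl: "closed_in G W"
  proof -
    have "component_of G x = component_of G y \<and> x \<in> pverts G \<and> y \<in> pverts G" if "(x, y) \<in> parcs G" for x y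
      using that on component_of_eq_iff[OF assms] by (auto simp: finite_wf_def)
    then show ?thesis by (auto simp: closed_in_def W_def)
  qed
  have "component_of (prune m G) v = component_of G v" if "v \<in> pverts G \<inter> W" for v
    using that component_of_induced_on[OF on cl] by (auto simp: prune)
  then have "components_of (prune m G) = component_of G ` (pverts G \<inter> W)"
    by (auto simp: components_of_def prune)
  then show comps: "components_of (prune m G) = {C \<in> components_of G. m \<le> card C}"
    by (auto simp: components_of_def W_def)
  fix C assume "C \<in> components_of (prune m G)"
  then obtain v where v: "v \<in> pverts G" "C = component_of G v" "m \<le> card C"
    unfolding comps by (auto simp: components_of_def)
  have "C \<subseteq> W"
  proof
    fix w assume w: "w \<in> C"
    then have "w \<in> pverts G" using component_of_subset[OF on v(1)] v by auto
    moreover have "component_of G w = C"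
      using w v component_of_eq_iff[OF assms v(1) \<open>w \<in> pverts G\<close>] component_of_eq[OF on v(1)] by auto
    ultimately show "w \<in> W" using v by (simp add: W_def)
  qed
  then show "induced_on (prune m G) C = induced_on G C"
    by (simp add: prune Int_absorb1)
qed

lemma is_forest_prune: "is_forest G \<Longrightarrow> is_forest (prune m G)"
  unfolding prune_def by (rule is_forest_induced_on)

section \<open>Rooted trees as binary terms\<close>

text \<open>
  A rooted tree is either a single vertex or arises by hanging a rooted tree below the root of another
  rooted tree. Unlike the description by a list of subtrees, this one uses a single binary
  operation, under which types form a finite algebra; vertices of large degree and long paths
  then need no separate treatment.
\<close>

datatype shape = Leaf | Graft shape shape

fun leaves :: "shape \<Rightarrow> nat" where
  "leaves Leaf = 1"
| "leaves (Graft x y) = leaves x + leaves y"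

lemma leaves_pos: "0 < leaves t"
  by (induction t) auto

inductive represents :: "shape \<Rightarrow> 'a pair_pre_digraph \<Rightarrow> 'a \<Rightarrow> bool" where
  "represents Leaf \<lparr> pverts = {r}, parcs = {} \<rparr> r"
| "represents t G r \<Longrightarrow> represents u H q \<Longrightarrow> pverts G \<inter> pverts H = {} \<Longrightarrow>
   represents (Graft t u)
     \<lparr> pverts = pverts G \<union> pverts H, parcs = parcs G \<union> parcs H \<union> {(r, q), (q, r)} \<rparr> r"

definition edges :: "'a pair_pre_digraph \<Rightarrow> 'a set set" where
  "edges G = (\<lambda>(u, v). {u, v}) ` parcs G"

lemma represents_basic:
  assumes "represents t G r"
  shows "r \<in> pverts G" "pair_graph G" "card (pverts G) = leaves t" "card (edges G) < leaves t"
    "\<forall>v\<in>pverts G. (r, v) \<in> (parcs G)\<^sup>*"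
  using assms
proof (induction rule: represents.induct)
  case (1 r)
  case 1 show ?case by simp
  case 2 show ?case by (simp add: pair_graph_iff sym_def irrefl_def)
  case 3 show ?case by simp
  case 4 show ?case by (simp add: edges_def)
  case 5 show ?case by simp
next
  case (2 t G r u H q)
  let ?J = "\<lparr> pverts = pverts G \<union> pverts H, parcs = parcs G \<union> parcs H \<union> {(r, q), (q, r)} \<rparr>"
  have "r \<noteq> q" using 2 by auto
  {
    case 1 show ?case using 2 by simp
  next
    case 2 show ?case using "2.IH" \<open>r \<noteq> q\<close> by (auto simp: pair_graph_iff sym_def irrefl_def)
  next
    case 3 show ?case using "2.IH" "2.hyps" by (simp add: card_Un_disjoint pair_graph_iff)
  next
    case 4
    have fin: "finite (edges G)" "finite (edges H)"
      using "2.IH" unfolding edges_def pair_graph_iff by (meson finite_SigmaI finite_imageI finite_subset)+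
    have "edges ?J = insert {r, q} (edges G \<union> edges H)" by (auto simp: edges_def)
    then have "card (edges ?J) \<le> Suc (card (edges G) + card (edges H))"
      using card_insert_le_m1 card_Un_le[of "edges G" "edges H"]
      by (metis (no_types, lifting) Suc_le_mono card_insert_if fin finite_UnI le_SucI)
    then show ?case using "2.IH" by simp
  next
    case 5
    have G: "(r, v) \<in> (parcs ?J)\<^sup>*" if "v \<in> pverts G" for v
      using "2.IH"(5) that rtrancl_mono[of "parcs G" "parcs ?J"] by auto
    have H: "(q, v) \<in> (parcs ?J)\<^sup>*" if "v \<in> pverts H" for v
      using "2.IH"(10) that rtrancl_mono[of "parcs H" "parcs ?J"] by auto
    have "(r, q) \<in> parcs ?J" by simp
    then show ?case using G H by (auto intro: converse_rtrancl_into_rtrancl)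
  }
qed

text \<open>
  Collapsing the part \<open>W\<close> to the vertex \<open>r\<close> maps a detour around \<open>e\<close> in the joined graph to a detour
  in the part \<open>V\<close>.
\<close>

lemma bridge_in_joined:
  assumes E: "E \<subseteq> V \<times> V" and F: "F \<subseteq> W \<times> W" and disj: "V \<inter> W = {}" and rq: "r \<in> V" "q \<in> W"
    and sym: "sym E"
    and "e \<in> E" "bridge_in E e"
  shows "bridge_in (E \<union> F \<union> {(r, q), (q, r)}) e"
proof -
  obtain u v where e: "e = (u, v)" by (cases e)
  then have uv: "u \<in> V" "v \<in> V" using assms by auto
  \<comment> \<open>the collapse of \<open>W\<close> to \<open>r\<close>\<close>
  define f where "f = (\<lambda>x. if x \<in> V then x else r)"
  let ?D = "{(u, v), (v, u)}"
  have "(f x, f y) \<in> (E - ?D)\<^sup>*" if "(x, y) \<in> (E \<union> F \<union> {(r, q), (q, r)} - ?D)\<^sup>*" for x y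
    using that
  proof (induction rule: rtrancl_induct)
    case (step y z)
    have "(f y, f z) \<in> (E - ?D)\<^sup>*"
    proof (cases "(y, z) \<in> E")
      case True
      then show ?thesis using step.hyps(2) E by (auto simp: f_def)
    next
      case False
      then have "f y = r" "f z = r" using step.hyps(2) F disj rq by (auto simp: f_def)
      then show ?thesis by simp
    qed
    with step.IH show ?case by (rule rtrancl_trans)
  qed simp
  from this[of u v] show ?thesis using assms(8) uv by (auto simp: bridge_in_def e f_def)
qed

lemma represents_is_tree:
  assumes "represents t G r"
  shows "is_tree G"
proof -
  have "is_forest G" using assms
  proof (induction rule: represents.induct)
    case (1 r)
    show ?case by (simp add: is_forest_iff_bridges pair_graph_iff sym_def irrefl_def)
  next
    case (2 t G r u H q)
    let ?J = "\<lparr> pverts = pverts G \<union> pverts H, parcs = parcs G \<union> parcs H \<union> {(r, q), (q, r)} \<rparr>"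
    note g = represents_basic[OF "2.hyps"(1)] and h = represents_basic[OF "2.hyps"(2)]
    have pg: "pair_graph ?J" using represents_basic(2)[OF represents.intros(2)[OF "2.hyps"]] .
    have on: "parcs G \<subseteq> pverts G \<times> pverts G" "parcs H \<subseteq> pverts H \<times> pverts H"
      and sym: "sym (parcs G)" "sym (parcs H)"
      using g h by (auto simp: pair_graph_iff)
    have b1: "bridge_in (parcs ?J) e" if "e \<in> parcs G" for e
      using bridge_in_joined[OF on "2.hyps"(3) g(1) h(1) sym(1) that] that "2.IH"(1)
      by (simp add: is_forest_iff_bridges)
    have "parcs ?J = parcs H \<union> parcs G \<union> {(q, r), (r, q)}" by auto
    then have b2: "bridge_in (parcs ?J) e" if "e \<in> parcs H" for e
      using bridge_in_joined[OF on(2,1) _ h(1) g(1) sym(2) that] that "2.IH"(2) "2.hyps"(3)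
      by (simp add: is_forest_iff_bridges Int_commute)
    have "y \<in> pverts G" if "(r, y) \<in> (parcs ?J - {(r, q), (q, r)})\<^sup>*" for y
      using that
    proof (induction rule: rtrancl_induct)
      case (step y z)
      then show ?case using on "2.hyps"(3) by auto
    qed (rule g(1))
    moreover have "y \<in> pverts H" if "(q, y) \<in> (parcs ?J - {(q, r), (r, q)})\<^sup>*" for y
      using that
    proof (induction rule: rtrancl_induct)
      case (step y z)
      then show ?case using on "2.hyps"(3) by auto
    qed (rule h(1))
    ultimately have "bridge_in (parcs ?J) (r, q)" "bridge_in (parcs ?J) (q, r)"
      using g(1) h(1) "2.hyps"(3) by (auto simp: bridge_in_def)
    then show ?case using b1 b2 pg by (auto simp: is_forest_iff_bridges)
  qed
  then show ?thesis using represents_basic[OF assms] by (intro is_treeI) auto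
qed

text \<open>
  Delete an edge at the root. It is a bridge, so the tree falls into the part that contains the root and
  the part that contains the other end of the edge, and both are smaller trees.
\<close>

lemma tree_is_represented:
  assumes "is_tree G" "r \<in> pverts G"
  shows "\<exists>t. represents t G r"
  using assms
proof (induction "card (pverts G)" arbitrary: G r rule: less_induct)
  case less
  have forest: "is_forest G" and pg: "pair_graph G" and on: "finite_wf G"
    using less.prems by (auto simp: is_tree_def is_forest_def intro: pair_graph_finite_wf)
  then have E: "parcs G \<subseteq> pverts G \<times> pverts G" "sym (parcs G)" "irrefl (parcs G)" "finite (pverts G)"
    by (auto simp: pair_graph_iff)
  have conn: "(u, v) \<in> (parcs G)\<^sup>*" if "u \<in> pverts G" "v \<in> pverts G" for u v
    using less.prems that by (auto simp: is_tree_iff)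
  show ?case
  proof (cases "pverts G = {r}")
    case True
    then have "parcs G = {}" using E by (auto simp: irrefl_def)
    then have "G = \<lparr> pverts = {r}, parcs = {} \<rparr>" using True by (intro pair_pre_digraph.equality) auto
    then show ?thesis using represents.intros(1)[of r] by auto
  next
    case False
    then obtain v where "v \<in> pverts G" "v \<noteq> r" using less.prems by blast
    with conn[OF less.prems(2), of v] obtain q where q: "(r, q) \<in> parcs G"
      by (auto elim: converse_rtranclE)
    then have "q \<in> pverts G" "q \<noteq> r" using E by (auto simp: irrefl_def)
    define F where "F = parcs G - {(r, q), (q, r)}"
    define W where "W = F\<^sup>* `` {r}"
    have "sym F" using E(2) by (auto simp: F_def sym_def)
    then have FW: "x \<in> W \<longleftrightarrow> y \<in> W" if "(x, y) \<in> F" for x y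
      using that by (auto simp: W_def dest: symD intro: rtrancl_into_rtrancl)
    have "r \<in> W" by (simp add: W_def)
    have "q \<notin> W"
      using forest q by (auto simp: is_forest_iff_bridges bridge_in_def W_def F_def)
    let ?G = "induced_on G W" and ?H = "induced_on G (- W)"
    have "is_tree ?G"
    proof (rule is_treeI)
      show "is_forest ?G" by (rule is_forest_induced_on[OF forest])
      show "r \<in> pverts ?G" using less.prems \<open>r \<in> W\<close> by simp
      fix v assume "v \<in> pverts ?G"
      then have "(r, v) \<in> F\<^sup>*" by (simp add: W_def)
      then have "(r, v) \<in> (parcs ?G)\<^sup>* \<and> v \<in> W"
      proof (induction rule: rtrancl_induct)
        case (step y z)
        then have "(y, z) \<in> parcs ?G" using FW by (auto simp: F_def)
        then show ?case using step by (auto intro: rtrancl_into_rtrancl)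
      qed (simp add: \<open>r \<in> W\<close>)
      then show "(r, v) \<in> (parcs ?G)\<^sup>*" ..
    qed
    moreover have "is_tree ?H"
    proof (rule is_treeI)
      show "is_forest ?H" by (rule is_forest_induced_on[OF forest])
      show "q \<in> pverts ?H" using \<open>q \<in> pverts G\<close> \<open>q \<notin> W\<close> by simp
      \<comment> \<open>a walk from \<open>r\<close> can leave \<open>W\<close> only through the deleted edge, that is, to \<open>q\<close>\<close>
      have "y \<in> W \<or> (q, y) \<in> (parcs ?H)\<^sup>*" if "(r, y) \<in> (parcs G)\<^sup>*" for y
        using that
      proof (induction rule: rtrancl_induct)
        case (step y z)
        show ?case
        proof (cases "z \<in> W \<or> z = q")
          case False
          then have "(y, z) \<in> F" using step.hyps(2) \<open>r \<in> W\<close> by (auto simp: F_def)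
          then have "y \<notin> W" using FW False by blast
          then have "(y, z) \<in> parcs ?H" using step.hyps(2) False by simp
          then show ?thesis using step.IH \<open>y \<notin> W\<close> by (auto intro: rtrancl_into_rtrancl)
        qed auto
      qed (simp add: \<open>r \<in> W\<close>)
      then show "(q, v) \<in> (parcs ?H)\<^sup>*" if "v \<in> pverts ?H" for v
        using that conn[OF less.prems(2)] by auto
    qed
    moreover have "card (pverts ?G) < card (pverts G)"
      using E(4) \<open>q \<in> pverts G\<close> \<open>q \<notin> W\<close> by (intro psubset_card_mono) auto
    moreover have "card (pverts ?H) < card (pverts G)"
      using E(4) less.prems(2) \<open>r \<in> W\<close> by (intro psubset_card_mono) auto
    ultimately obtain t u where "represents t ?G r" "represents u ?H q"
      using less.hyps[of ?G r] less.hyps[of ?H q] less.prems(2) \<open>q \<in> pverts G\<close> \<open>q \<notin> W\<close> \<open>r \<in> W\<close> by auto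
    then have "represents (Graft t u) \<lparr> pverts = pverts ?G \<union> pverts ?H,
        parcs = parcs ?G \<union> parcs ?H \<union> {(r, q), (q, r)} \<rparr> r"
      by (rule represents.intros) auto
    also have "\<lparr> pverts = pverts ?G \<union> pverts ?H, parcs = parcs ?G \<union> parcs ?H \<union> {(r, q), (q, r)} \<rparr> = G"
    proof (rule pair_pre_digraph.equality)
      have "parcs G = F \<union> {(r, q), (q, r)}" using q E(2) by (auto simp: F_def dest: symD)
      moreover have "parcs ?G \<union> parcs ?H = F"
        using FW \<open>r \<in> W\<close> \<open>q \<notin> W\<close> by (auto simp: F_def)
      ultimately show "parcs \<lparr> pverts = pverts ?G \<union> pverts ?H,
          parcs = parcs ?G \<union> parcs ?H \<union> {(r, q), (q, r)} \<rparr> = parcs G" by simp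
    qed auto
    finally show ?thesis by blast
  qed
qed

lemma represents_on_set:
  assumes "finite S" "card S = leaves t"
  shows "\<exists>G r. represents t G r \<and> pverts G = S"
  using assms
proof (induction t arbitrary: S)
  case Leaf
  then obtain r where "S = {r}" by (auto simp: card_1_singleton_iff)
  then show ?case using represents.intros(1)[of r] by (metis pair_pre_digraph.select_convs(1))
next
  case (Graft x y)
  then obtain A where A: "A \<subseteq> S" "card A = leaves x"
    by (metis leaves.simps(2) le_add1 obtain_subset_with_card_n)
  then have "card (S - A) = leaves y" using Graft.prems by (simp add: card_Diff_subset finite_subset)
  with Graft A obtain G r H q where G: "represents x G r" "pverts G = A"
      and H: "represents y H q" "pverts H = S - A"
    by (meson finite_Diff finite_subset)
  have "pverts G \<inter> pverts H = {}" using G H by auto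
  from represents.intros(2)[OF G(1) H(1) this] show ?case
    using G(2) H(2) A(1) by (intro exI conjI) auto
qed

definition with_loop :: "'a \<Rightarrow> 'a pair_pre_digraph \<Rightarrow> 'a pair_pre_digraph" where
  "with_loop r G = \<lparr> pverts = pverts G, parcs = insert (r, r) (parcs G) \<rparr>"

lemma with_loop_Graft:
  assumes "represents t G r" "represents u H q"
  shows "with_loop r \<lparr> pverts = pverts G \<union> pverts H, parcs = parcs G \<union> parcs H \<union> {(r, q), (q, r)} \<rparr>
    = gjoin (with_loop r G) (with_loop q H)"
proof -
  have "irrefl (parcs G)" "irrefl (parcs H)"
    using represents_basic[OF assms(1)] represents_basic[OF assms(2)] by (auto simp: pair_graph_iff)
  then show ?thesis
    by (intro pair_pre_digraph.equality) (auto simp: with_loop_def gjoin_def irrefl_def)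
qed

lemma finite_wf_with_loop: "represents t G r \<Longrightarrow> finite_wf (with_loop r G)"
  using represents_basic[of t G r] by (auto simp: finite_wf_def pair_graph_iff with_loop_def)

lemma ef_type_Graft:
  assumes "represents t G r" "represents u H q" "pverts G \<inter> pverts H = {}"
    and "represents t' G' r'" "represents u' H' q'" "pverts G' \<inter> pverts H' = {}"
    and "ef_type s (with_loop r G) [] = ef_type s (with_loop r' G') []"
    and "ef_type s (with_loop q H) [] = ef_type s (with_loop q' H') []"
  shows "ef_type s (gjoin (with_loop r G) (with_loop q H)) []
       = ef_type s (gjoin (with_loop r' G') (with_loop q' H')) []"
proof (rule ef_type_gjoin)
  show "finite_wf (with_loop r G)" "finite_wf (with_loop q H)"
    "finite_wf (with_loop r' G')" "finite_wf (with_loop q' H')"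
    using assms by (auto intro: finite_wf_with_loop)
qed (use assms in \<open>auto simp: with_loop_def\<close>)

lemma represents_LeafE:
  assumes "represents Leaf G r" obtains "G = \<lparr> pverts = {r}, parcs = {} \<rparr>"
  using assms by (cases rule: represents.cases) auto

lemma represents_GraftE:
  assumes "represents (Graft t u) J r"
  obtains G H q where "represents t G r" "represents u H q" "pverts G \<inter> pverts H = {}"
    "with_loop r J = gjoin (with_loop r G) (with_loop q H)"
  using assms
proof (cases rule: represents.cases)
  case (2 G H q)
  then show ?thesis using that with_loop_Graft[OF 2(2,3)] by auto
qed

lemma ef_type_represents_unique:
  assumes "represents t (G :: 'a pair_pre_digraph) r" "represents t (H :: 'b pair_pre_digraph) q"
  shows "ef_type s (with_loop r G) [] = ef_type s (with_loop q H) []"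
  using assms
proof (induction t arbitrary: G r H q)
  case Leaf
  \<comment> \<open>the one-vertex graph, where every move chooses the same vertex again\<close>
  have single: "ef_type s \<lparr> pverts = {r}, parcs = {(r, r)} \<rparr> (replicate k r)
      = ef_type s \<lparr> pverts = {q}, parcs = {(q, q)} \<rparr> (replicate k q)" for s k and r :: 'a and q :: 'b
  proof (induction s arbitrary: k)
    case 0
    show ?case by (subst ef_type_0_eq) (auto dest!: set_zip_leftD set_zip_rightD)
  next
    case (Suc s)
    show ?case using Suc[of k] Suc[of "Suc k"] by (subst ef_type_Suc_eq) auto
  qed
  from Leaf show ?case
    using single[where k = 0] by (auto elim!: represents_LeafE simp: with_loop_def)
next
  case (Graft t u)
  from Graft.prems(1) obtain G1 G2 r2 where g: "represents t G1 r" "represents u G2 r2"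
    "pverts G1 \<inter> pverts G2 = {}" "with_loop r G = gjoin (with_loop r G1) (with_loop r2 G2)"
    by (rule represents_GraftE)
  from Graft.prems(2) obtain H1 H2 q2 where h: "represents t H1 q" "represents u H2 q2"
    "pverts H1 \<inter> pverts H2 = {}" "with_loop q H = gjoin (with_loop q H1) (with_loop q2 H2)"
    by (rule represents_GraftE)
  show ?case unfolding g(4) h(4)
    by (rule ef_type_Graft[OF g(1-3) h(1-3) Graft.IH(1)[OF g(1) h(1)] Graft.IH(2)[OF g(2) h(2)]])
qed

text \<open>
  The type of a tree of this shape marked at its root; by the previous lemma it does not depend on
  the representing graph.
\<close>

definition shape_type :: "nat \<Rightarrow> shape \<Rightarrow> nat" where
  "shape_type s t = (SOME x. \<exists>(G :: nat pair_pre_digraph) r. represents t G r \<and> x = ef_type s (with_loop r G) [])"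

lemma shape_type_eq:
  fixes G :: "nat pair_pre_digraph"
  assumes "represents t G r"
  shows "shape_type s t = ef_type s (with_loop r G) []"
  unfolding shape_type_def
proof (rule some_equality)
  fix x assume "\<exists>(G :: nat pair_pre_digraph) r. represents t G r \<and> x = ef_type s (with_loop r G) []"
  then show "x = ef_type s (with_loop r G) []" using ef_type_represents_unique[OF _ assms] by auto
qed (use assms in blast)

lemma represents_exists: "\<exists>(G :: nat pair_pre_digraph) r. represents t G r"
  using represents_on_set[of "{..<leaves t}" t] by auto

lemma finite_range_shape_type: "finite (range (shape_type s))"
proof (rule finite_subset)
  show "range (shape_type s) \<subseteq> {ef_type s G as | (G :: nat pair_pre_digraph) as. length as = 0}"
  proof clarify
    fix t
    obtain G :: "nat pair_pre_digraph" and r where "represents t G r" using represents_exists by blast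
    then show "\<exists>(G :: nat pair_pre_digraph) as. shape_type s t = ef_type s G as \<and> length as = 0"
      using shape_type_eq[of t G r s] by auto
  qed
qed (rule finitely_many_ef_types)

text \<open>
  The type is a homomorphism from shapes to a finite algebra with one binary operation.
\<close>

lemma shape_type_cong:
  assumes "shape_type s t = shape_type s t'" "shape_type s u = shape_type s u'"
  shows "shape_type s (Graft t u) = shape_type s (Graft t' u')"
proof -
  obtain J :: "nat pair_pre_digraph" and r where J: "represents (Graft t u) J r"
    using represents_exists by blast
  obtain J' :: "nat pair_pre_digraph" and r' where J': "represents (Graft t' u') J' r'"
    using represents_exists by blast
  obtain G H q where g: "represents t G r" "represents u H q"
    "pverts G \<inter> pverts H = {}" "with_loop r J = gjoin (with_loop r G) (with_loop q H)"
    using J by (rule represents_GraftE)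
  obtain G' H' q' where h: "represents t' G' r'" "represents u' H' q'"
    "pverts G' \<inter> pverts H' = {}" "with_loop r' J' = gjoin (with_loop r' G') (with_loop q' H')"
    using J' by (rule represents_GraftE)
  show ?thesis
    unfolding shape_type_eq[OF J] shape_type_eq[OF J'] g(4) h(4)
    by (rule ef_type_Graft[OF g(1-3) h(1-3)])
      (use assms in \<open>simp_all add: shape_type_eq[OF g(1)] shape_type_eq[OF g(2)]
        shape_type_eq[OF h(1)] shape_type_eq[OF h(2)]\<close>)
qed

section \<open>Pumping rooted trees\<close>

text \<open>
  Contexts: shapes with one hole. The number counts the leaves outside the hole.
\<close>

inductive shape_context :: "(shape \<Rightarrow> shape) \<Rightarrow> nat \<Rightarrow> bool" where
  "shape_context (\<lambda>x. x) 0"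
| "shape_context c k \<Longrightarrow> shape_context (\<lambda>x. Graft (c x) u) (k + leaves u)"
| "shape_context c k \<Longrightarrow> shape_context (\<lambda>x. Graft u (c x)) (k + leaves u)"

lemma leaves_shape_context: "shape_context c k \<Longrightarrow> leaves (c x) = leaves x + k"
  by (induction rule: shape_context.induct) auto

lemma shape_context_cong:
  assumes "\<And>t t' u u'. h t = h t' \<Longrightarrow> h u = h u' \<Longrightarrow> h (Graft t u) = h (Graft t' u')"
    and "shape_context c k" "h x = h y"
  shows "h (c x) = h (c y)"
  using assms(2,3) by (induction rule: shape_context.induct) (auto intro: assms(1))

text \<open>
  If no value is repeated along a branch, the value at the top does not occur further down, so the
  two parts use one value less, and the number of leaves at most doubles with each value.
\<close>

lemma many_leaves_imp_repetition:
  assumes "finite A" "\<And>c k x. shape_context c k \<Longrightarrow> t = c x \<Longrightarrow> h x \<in> A" "2 ^ card A < leaves t"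
  shows "\<exists>c k d j x. shape_context c k \<and> shape_context d j \<and> 0 < j \<and> t = c (d x) \<and> h (d x) = h x"
  using assms
proof (induction t arbitrary: A)
  case Leaf
  then show ?case by simp
next
  case (Graft a b)
  have inA: "h (Graft a b) \<in> A" using Graft.prems(2)[OF shape_context.intros(1)] by simp
  show ?case
  proof (rule ccontr)
    assume none: "\<not> ?thesis"
    have A': "finite (A - {h (Graft a b)})" "card (A - {h (Graft a b)}) = card A - 1" "card A > 0"
      using Graft.prems(1) inA by (auto simp: card_gt_0_iff)
    have neq: "h x \<noteq> h (Graft a b)" if "shape_context c k" "0 < k" "Graft a b = c x" for c k x
      using none that shape_context.intros(1) by metis
    have small: "leaves a \<le> 2 ^ (card A - 1)"
    proof (rule ccontr)
      assume "\<not> leaves a \<le> 2 ^ (card A - 1)"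
      moreover have "h x \<in> A - {h (Graft a b)}" if "shape_context c k" "a = c x" for c k x
        using Graft.prems(2)[OF shape_context.intros(2)[OF that(1), of b], of x]
          neq[OF shape_context.intros(2)[OF that(1), of b], of x] that leaves_pos[of b] by auto
      ultimately obtain c k d j x where "shape_context c k" "shape_context d j" "0 < j"
          "a = c (d x)" "h (d x) = h x"
        using Graft.IH(1)[OF A'(1)] A'(2) by (metis not_le_imp_less)
      then show False using none shape_context.intros(2)[of c k b] by blast
    qed
    have small': "leaves b \<le> 2 ^ (card A - 1)"
    proof (rule ccontr)
      assume "\<not> leaves b \<le> 2 ^ (card A - 1)"
      moreover have "h x \<in> A - {h (Graft a b)}" if "shape_context c k" "b = c x" for c k x
        using Graft.prems(2)[OF shape_context.intros(3)[OF that(1), of a], of x]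
          neq[OF shape_context.intros(3)[OF that(1), of a], of x] that leaves_pos[of a] by auto
      ultimately obtain c k d j x where "shape_context c k" "shape_context d j" "0 < j"
          "b = c (d x)" "h (d x) = h x"
        using Graft.IH(2)[OF A'(1)] A'(2) by (metis not_le_imp_less)
      then show False using none shape_context.intros(3)[of c k a] by blast
    qed
    have "leaves (Graft a b) \<le> 2 ^ (card A - 1) + 2 ^ (card A - 1)" using small small' by simp
    also have "\<dots> = 2 ^ card A" using A'(3) by (cases "card A") auto
    finally show False using Graft.prems(3) by simp
  qed
qed

text \<open>
  The segment between two occurrences of the same value can be repeated any number of times, which
  gives all leaf counts in an arithmetic progression.
\<close>

lemma pumping:
  assumes "\<And>t t' u u'. h t = h t' \<Longrightarrow> h u = h u' \<Longrightarrow> h (Graft t u) = h (Graft t' u')"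
    and "finite (range h)" "2 ^ card (range h) < leaves t"
  shows "\<exists>L. \<forall>N. \<exists>u. h u = h t \<and> N \<le> leaves u \<and> leaves u \<le> N + L"
proof -
  obtain c k d j x where c: "shape_context c k" and d: "shape_context d j" "0 < j"
      and t: "t = c (d x)" and h: "h (d x) = h x"
    using many_leaves_imp_repetition[OF assms(2) _ assms(3), of h] by blast
  have dn: "h ((d ^^ i) x) = h x \<and> leaves ((d ^^ i) x) = leaves x + i * j" for i
  proof (induction i)
    case (Suc i)
    then have "h (d ((d ^^ i) x)) = h (d x)" using shape_context_cong[where h = h, OF assms(1) d(1)] by blast
    then show ?case using Suc leaves_shape_context[OF d(1)] h by simp
  qed simp
  have hc: "h (c ((d ^^ i) x)) = h t" for i
    unfolding t using shape_context_cong[where h = h, OF assms(1) c] dn[of i] h by metis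
  have lc: "leaves (c ((d ^^ i) x)) = leaves x + k + i * j" for i
    using leaves_shape_context[OF c] dn[of i] by simp
  show ?thesis
  proof (intro exI[of _ "leaves x + k + j"] allI)
    \<comment> \<open>\<open>Suc (N div j)\<close> repetitions give the first multiple of \<open>j\<close> beyond \<open>N\<close>\<close>
    fix N
    have "N \<le> Suc (N div j) * j" using d(2)
      by (metis dividend_less_div_times less_imp_le mult_Suc add.commute)
    moreover have "Suc (N div j) * j \<le> N + j" by simp
    ultimately show "\<exists>u. h u = h t \<and> N \<le> leaves u \<and> leaves u \<le> N + (leaves x + k + j)"
      using hc[of "Suc (N div j)"] lc[of "Suc (N div j)"]
      by (intro exI[of _ "c ((d ^^ Suc (N div j)) x)"]) linarith
  qed
qed

section \<open>Component types\<close>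

lemma is_tree_finite: "is_tree G \<Longrightarrow> finite (pverts G)"
  by (simp add: is_tree_def is_forest_def pair_graph_iff)

lemma tree_equiv_class:
  fixes A :: "nat pair_pre_digraph"
  assumes "is_tree A"
  shows "tree_equiv s `` {A} = {B. is_tree B \<and> ef_type s B [] = ef_type s A []}"
proof -
  have "s_theory s A = s_theory s B \<longleftrightarrow> ef_type s B [] = ef_type s A []" if "is_tree B" for B :: "nat pair_pre_digraph"
    using s_theory_eq_iff_ef_type[of A B s] is_tree_finite[OF assms] is_tree_finite[OF that] by auto
  then show ?thesis using assms by (auto simp: tree_equiv_def)
qed

lemma component_typesE:
  assumes "\<tau> \<in> component_types s"
  obtains A :: "nat pair_pre_digraph" where "is_tree A" "\<tau> = {B. is_tree B \<and> ef_type s B [] = ef_type s A []}"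
proof -
  from assms obtain A where A: "is_tree A" "\<tau> = tree_equiv s `` {A}"
    by (auto simp: component_types_def quotient_def)
  then show thesis using that tree_equiv_class by blast
qed

lemma component_type_of_tree:
  fixes A :: "nat pair_pre_digraph"
  assumes "is_tree A"
  shows "{B. is_tree B \<and> ef_type s B [] = ef_type s A []} \<in> component_types s"
  unfolding component_types_def tree_equiv_class[OF assms, symmetric]
  using assms by (intro quotientI) simp

lemma finite_component_types: "finite (component_types s)"
proof (rule finite_subset)
  show "component_types s \<subseteq> (\<lambda>x. {B. is_tree B \<and> ef_type s B [] = x}) `
      {ef_type s G as | (G :: nat pair_pre_digraph) as. length as = 0}"
    by (fastforce elim!: component_typesE)
  show "finite ((\<lambda>x. {B. is_tree B \<and> ef_type s B [] = x}) `
      {ef_type s G as | (G :: nat pair_pre_digraph) as. length as = 0})"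
    by (intro finite_imageI finitely_many_ef_types)
qed

lemma bounded_types_bound:
  "\<exists>B. \<forall>\<tau>\<in>component_types s. \<not> unbounded_type \<tau> \<longrightarrow> (\<forall>A\<in>\<tau>. card (pverts A) \<le> B)"
proof -
  have "\<forall>\<tau>. \<exists>N. \<not> unbounded_type \<tau> \<longrightarrow> (\<forall>A\<in>\<tau>. card (pverts A) \<le> N)"
    by (auto simp: unbounded_type_def not_le intro: less_imp_le)
  then obtain N where N: "\<And>\<tau> A. \<not> unbounded_type \<tau> \<Longrightarrow> A \<in> \<tau> \<Longrightarrow> card (pverts A) \<le> N \<tau>" by metis
  have "N \<tau> \<le> Max (N ` component_types s)" if "\<tau> \<in> component_types s" for \<tau>
    using that finite_component_types by auto
  then have "card (pverts A) \<le> Max (N ` component_types s)"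
    if "\<tau> \<in> component_types s" "\<not> unbounded_type \<tau>" "A \<in> \<tau>" for \<tau> A
    using N[OF that(2,3)] that(1) by fastforce
  then show ?thesis by blast
qed

text \<open>
  An unbounded type does not merely contain large trees: the orders of its trees have bounded gaps. The
  order of the tree enters the exponent of the expected number of its copies, and the growth
  condition on the pruning threshold only allows for orders within a constant factor of it.
\<close>

lemma unbounded_type_shapes:
  assumes "\<tau> \<in> component_types s" "unbounded_type \<tau>"
  shows "\<exists>L. \<forall>N. \<exists>t. N \<le> leaves t \<and> leaves t \<le> N + L \<and>
     (\<forall>(G :: nat pair_pre_digraph) r. represents t G r \<longrightarrow> G \<in> \<tau>)"
proof -
  obtain A0 :: "nat pair_pre_digraph" where A0: "is_tree A0" "\<tau> = {B. is_tree B \<and> ef_type s B [] = ef_type s A0 []}"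
    using assms(1) by (rule component_typesE)
  obtain A where A: "A \<in> \<tau>" "Suc (2 ^ card (range (shape_type s))) \<le> card (pverts A)"
    using assms(2) unfolding unbounded_type_def by blast
  then have "is_tree A" using A0 by simp
  then have "pverts A \<noteq> {}" unfolding is_tree_iff by blast
  then obtain r where "r \<in> pverts A" by blast
  from tree_is_represented[OF \<open>is_tree A\<close> this] obtain t where t: "represents t A r" by blast
  then have "2 ^ card (range (shape_type s)) < leaves t" using A(2) represents_basic(3) by fastforce
  from pumping[of "shape_type s", OF shape_type_cong finite_range_shape_type this]
  obtain L where L: "\<And>N. \<exists>u. shape_type s u = shape_type s t \<and> N \<le> leaves u \<and> leaves u \<le> N + L"
    by blast
  have "G \<in> \<tau>" if "shape_type s u = shape_type s t" "represents u G q" for u q and G :: "nat pair_pre_digraph"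
  proof -
    have "ef_type s (with_loop q G) [] = ef_type s (with_loop r A) []"
      using that shape_type_eq[OF that(2)] shape_type_eq[OF t] by simp
    then have "ef_type s G [] = ef_type s A []"
    proof (rule ef_type_no_loops)
      show "parcs G = {(x, y) \<in> parcs (with_loop q G). x \<noteq> y}"
        "parcs A = {(x, y) \<in> parcs (with_loop r A). x \<noteq> y}"
        using represents_basic(2)[OF that(2)] represents_basic(2)[OF t]
        by (auto simp: with_loop_def pair_graph_iff irrefl_def)
      show "finite (pverts (with_loop q G))" "finite (pverts (with_loop r A))"
        using represents_basic(2)[OF that(2)] represents_basic(2)[OF t]
        by (auto simp: with_loop_def pair_graph_iff)
    qed (simp_all add: with_loop_def)
    then show ?thesis using A A0 represents_is_tree[OF that(2)] by simp
  qed
  with L show ?thesis by metis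
qed

section \<open>A second moment bound\<close>

text \<open>
  Chebyshev's inequality for the number of events that occur, when the events are pairwise almost
  negatively correlated, up to the factor \<open>1 + \<delta>\<close>.
\<close>

lemma prob_few_events_le:
  fixes A :: "'i \<Rightarrow> 'a set"
  assumes fin: "finite I" and "0 \<le> \<delta>"
    and pairs: "\<And>i j. i \<in> I \<Longrightarrow> j \<in> I \<Longrightarrow> i \<noteq> j \<Longrightarrow>
      measure_pmf.prob P (A i \<inter> A j) \<le> (1 + \<delta>) * (measure_pmf.prob P (A i) * measure_pmf.prob P (A j))"
    and \<mu>: "\<mu> = (\<Sum>i\<in>I. measure_pmf.prob P (A i))" "real K < \<mu>"
  shows "measure_pmf.prob P {x. card {i \<in> I. x \<in> A i} < K} \<le> (\<mu> + \<delta> * \<mu>\<^sup>2) / (\<mu> - K)\<^sup>2"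
proof -
  define X :: "'a \<Rightarrow> real" where "X = (\<lambda>x. \<Sum>i\<in>I. indicator (A i) x)"
  have X_card: "X x = real (card {i \<in> I. x \<in> A i})" for x
    using fin by (simp add: X_def indicator_def sum.If_cases Int_def)
  have int1: "integrable (measure_pmf P) (\<lambda>x. indicator B x :: real)" for B
    by (rule measure_pmf.integrable_const_bound[where B = 1]) auto
  have int2: "integrable (measure_pmf P) (\<lambda>x. indicator B x * indicator C x :: real)" for B C
    using int1[of "B \<inter> C"] by (simp add: indicator_inter_arith)
  have E1: "measure_pmf.expectation P X = \<mu>"
    unfolding X_def using int1 by (simp add: Bochner_Integration.integral_sum \<mu>)
  have X2: "(X x)\<^sup>2 = (\<Sum>i\<in>I. \<Sum>j\<in>I. indicator (A i) x * indicator (A j) x)" for x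
    by (simp add: X_def power2_eq_square sum_product)
  have intX2: "integrable (measure_pmf P) (\<lambda>x. (X x)\<^sup>2)"
    unfolding X2 using int2 by (intro Bochner_Integration.integrable_sum)
  have intX: "integrable (measure_pmf P) X"
    unfolding X_def using int1 by (intro Bochner_Integration.integrable_sum)
  have "measure_pmf.expectation P (\<lambda>x. (X x)\<^sup>2) = (\<Sum>i\<in>I. \<Sum>j\<in>I. measure_pmf.prob P (A i \<inter> A j))"
    unfolding X2 using int2 by (simp add: Bochner_Integration.integral_sum flip: indicator_inter_arith)
  also have "\<dots> \<le> (\<Sum>i\<in>I. \<Sum>j\<in>I. (if i = j then measure_pmf.prob P (A i) else 0) +
      (1 + \<delta>) * (measure_pmf.prob P (A i) * measure_pmf.prob P (A j)))"
    using pairs \<open>0 \<le> \<delta>\<close> by (intro sum_mono) (auto simp: add_increasing2)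
  also have "\<dots> = \<mu> + (1 + \<delta>) * \<mu>\<^sup>2"
    using fin by (simp add: sum.distrib \<mu> power2_eq_square sum_product flip: sum_distrib_left)
  finally have E2: "measure_pmf.expectation P (\<lambda>x. (X x)\<^sup>2) \<le> \<mu> + (1 + \<delta>) * \<mu>\<^sup>2" .
  have "measure_pmf.variance P X = measure_pmf.expectation P (\<lambda>x. (X x)\<^sup>2) - \<mu>\<^sup>2"
    using measure_pmf.variance_eq[OF intX intX2] E1 by simp
  then have var: "measure_pmf.variance P X \<le> \<mu> + \<delta> * \<mu>\<^sup>2" using E2 by (simp add: algebra_simps)
  have "measure_pmf.prob P {x. card {i \<in> I. x \<in> A i} < K} \<le> measure_pmf.prob P {x. \<mu> - K \<le> \<bar>X x - \<mu>\<bar>}"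
    by (intro measure_pmf.finite_measure_mono) (auto simp: X_card)
  also have "\<dots> \<le> measure_pmf.variance P X / (\<mu> - K)\<^sup>2"
    using measure_pmf.Chebyshev_inequality[of X P "\<mu> - K"] intX2 \<mu>(2) E1 by simp
  also have "\<dots> \<le> (\<mu> + \<delta> * \<mu>\<^sup>2) / (\<mu> - K)\<^sup>2" using var by (intro divide_right_mono) auto
  finally show ?thesis .
qed

section \<open>The random graph as a product of coin tosses\<close>

definition pairs_of :: "nat \<Rightarrow> nat set set" where
  "pairs_of n = {e. e \<subseteq> {1..n} \<and> card e = 2}"

definition graph_of :: "nat \<Rightarrow> (nat set \<Rightarrow> bool) \<Rightarrow> nat pair_pre_digraph" where
  "graph_of n X = \<lparr> pverts = {1..n},
     parcs = {(u, v). u \<in> {1..n} \<and> v \<in> {1..n} \<and> u \<noteq> v \<and> X {u, v}} \<rparr>"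

definition edge_pmf :: "nat \<Rightarrow> real \<Rightarrow> (nat set \<Rightarrow> bool) pmf" where
  "edge_pmf n p = Pi_pmf (pairs_of n) False (\<lambda>_. bernoulli_pmf p)"

lemma gnp_eq: "gnp n p = map_pmf (graph_of n) (edge_pmf n p)"
  by (simp add: gnp_def edge_pmf_def pairs_of_def graph_of_def[abs_def])

lemma prob_gnp:
  "measure_pmf.prob (gnp n p) {G. Q G} = measure_pmf.prob (edge_pmf n p) {X. Q (graph_of n X)}"
  by (simp add: gnp_eq vimage_def)

lemma pair_graph_graph_of: "pair_graph (graph_of n X)"
  by (auto simp: pair_graph_iff graph_of_def sym_def irrefl_def insert_commute)

lemma finite_pairs_of [simp]: "finite (pairs_of n)"
  by (rule finite_subset[of _ "Pow {1..n}"]) (auto simp: pairs_of_def)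

lemma prob_edge_pattern:
  assumes "D \<subseteq> pairs_of n" "0 \<le> p" "p \<le> 1"
  shows "measure_pmf.prob (edge_pmf n p) {X. \<forall>e\<in>D. X e = g e} = (\<Prod>e\<in>D. if g e then p else 1 - p)"
proof -
  have "{X. \<forall>e\<in>D. X e = g e} = Pi (pairs_of n) (\<lambda>e. if e \<in> D then {g e} else UNIV)"
    using assms(1) by (auto simp: Pi_def)
  then have "measure_pmf.prob (edge_pmf n p) {X. \<forall>e\<in>D. X e = g e} =
      (\<Prod>e\<in>pairs_of n. measure_pmf.prob (bernoulli_pmf p) (if e \<in> D then {g e} else UNIV))"
    unfolding edge_pmf_def by (simp add: measure_Pi_pmf_Pi)
  also have "\<dots> = (\<Prod>e\<in>D. measure_pmf.prob (bernoulli_pmf p) {g e})"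
    using assms(1) by (intro prod.mono_neutral_cong_right) auto
  also have "\<dots> = (\<Prod>e\<in>D. if g e then p else 1 - p)"
    using assms(2,3) by (intro prod.cong) (auto simp: measure_pmf_single)
  finally show ?thesis .
qed

section \<open>Absence of cycles\<close>

definition cycle_edges :: "nat list \<Rightarrow> nat set set" where
  "cycle_edges vs = (\<lambda>i. {vs ! i, vs ! (Suc i mod length vs)}) ` {..<length vs}"

lemma cycle_edges_props:
  assumes "distinct vs" "3 \<le> length vs" "set vs \<subseteq> {1..n}"
  shows "card (cycle_edges vs) = length vs" "cycle_edges vs \<subseteq> pairs_of n"
proof -
  let ?k = "length vs"
  have eq: "vs ! i = vs ! j \<longleftrightarrow> i = j" if "i < ?k" "j < ?k" for i j
    using assms(1) that by (simp add: nth_eq_iff_index_eq)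
  have lt: "Suc i mod ?k < ?k" for i using assms(2) by (intro mod_less_divisor) linarith
  \<comment> \<open>for length two the edges \<open>0\<close> and \<open>1\<close> would coincide; from length three on they are distinct\<close>
  have succ: "Suc i mod ?k = (if Suc i = ?k then 0 else Suc i)" if "i < ?k" for i
    using that by auto
  have "inj_on (\<lambda>i. {vs ! i, vs ! (Suc i mod ?k)}) {..<?k}"
  proof (rule inj_onI)
    fix i j assume ij: "i \<in> {..<?k}" "j \<in> {..<?k}"
      and "{vs ! i, vs ! (Suc i mod ?k)} = {vs ! j, vs ! (Suc j mod ?k)}"
    then have "i = j \<or> i = Suc j mod ?k \<and> Suc i mod ?k = j"
      using eq lt by (auto simp: doubleton_eq_iff)
    then show "i = j" using ij assms(2) succ by (auto split: if_splits)
  qed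
  then show "card (cycle_edges vs) = ?k" by (simp add: cycle_edges_def card_image)
  show "cycle_edges vs \<subseteq> pairs_of n"
  proof
    fix e assume "e \<in> cycle_edges vs"
    then obtain i where i: "i < ?k" "e = {vs ! i, vs ! (Suc i mod ?k)}" by (auto simp: cycle_edges_def)
    have "i \<noteq> Suc i mod ?k" using succ[OF i(1)] assms(2) by auto
    then have "vs ! i \<noteq> vs ! (Suc i mod ?k)" using eq[OF i(1) lt] by simp
    moreover have "vs ! i \<in> {1..n}" "vs ! (Suc i mod ?k) \<in> {1..n}"
      using assms(3) i(1) lt by (meson nth_mem subsetD)+
    ultimately show "e \<in> pairs_of n" by (simp add: i(2) pairs_of_def)
  qed
qed

lemma cyclic_list_cycle_edges:
  assumes "cyclic_list (parcs (graph_of n X)) vs" "e \<in> cycle_edges vs"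
  shows "X e"
proof -
  let ?k = "length vs"
  from assms(2) obtain i where i: "i < ?k" "e = {vs ! i, vs ! (Suc i mod ?k)}"
    by (auto simp: cycle_edges_def)
  have "(vs ! i, vs ! (Suc i mod ?k)) \<in> parcs (graph_of n X)"
  proof (cases "Suc i < ?k")
    case True
    then show ?thesis using assms(1) by (simp add: cyclic_list_def)
  next
    case False
    then have "Suc i = ?k" using i by simp
    moreover from this have "vs \<noteq> []" "i = ?k - 1" by auto
    ultimately show ?thesis using assms(1) by (simp add: cyclic_list_def last_conv_nth hd_conv_nth)
  qed
  then show ?thesis by (simp add: graph_of_def i(2))
qed

text \<open>
  Union bound: there are at most \<open>n\<^sup>k\<close> vertex lists of length \<open>k\<close>, and each of them is a cycle with
  probability \<open>p\<^sup>k\<close>.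
\<close>

lemma prob_not_forest_le:
  assumes "0 \<le> p" "real n * p < 1"
  shows "measure_pmf.prob (gnp n p) {G. \<not> is_forest G} \<le> (real n * p) ^ 3 / (1 - real n * p)"
proof (cases "n = 0")
  case True
  have "is_forest (graph_of 0 X)" for X
    using pair_graph_graph_of[of 0 X] by (auto simp: is_forest_iff_bridges graph_of_def)
  then show ?thesis using True by (simp add: prob_gnp)
next
  case False
  let ?c = "real n * p"
  have "p \<le> ?c" using False assms(1) by (intro mult_le_cancel_right1[THEN iffD2]) auto
  then have p1: "p \<le> 1" using assms by linarith
  define L where "L = (\<lambda>k. {vs. set vs \<subseteq> {1..n} \<and> length vs = k \<and> distinct vs})"
  define C where "C = (\<lambda>vs. {X :: nat set \<Rightarrow> bool. \<forall>e\<in>cycle_edges vs. X e = True})"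
  have finL: "finite (L k)" for k
    by (rule finite_subset[OF _ finite_lists_length_eq[of "{1..n}" k]]) (auto simp: L_def)
  have cardL: "card (L k) \<le> n ^ k" for k
  proof -
    have "card (L k) \<le> card {vs. set vs \<subseteq> {1..n} \<and> length vs = k}"
      by (intro card_mono finite_lists_length_eq) (auto simp: L_def)
    then show ?thesis by (simp add: card_lists_length_eq)
  qed
  have probC: "measure_pmf.prob (edge_pmf n p) (C vs) = p ^ k" if "vs \<in> L k" "3 \<le> k" for vs k
  proof -
    have *: "card (cycle_edges vs) = k" "cycle_edges vs \<subseteq> pairs_of n"
      using cycle_edges_props[of vs n] that by (auto simp: L_def)
    then show ?thesis
      unfolding C_def using prob_edge_pattern[OF *(2) assms(1) p1, of "\<lambda>_. True"] by simp
  qed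
  have "{X. \<not> is_forest (graph_of n X)} \<subseteq> (\<Union>k\<in>{3..n}. \<Union>vs\<in>L k. C vs)"
  proof
    fix X assume "X \<in> {X. \<not> is_forest (graph_of n X)}"
    then obtain vs where vs: "cyclic_list (parcs (graph_of n X)) vs" "set vs \<subseteq> pverts (graph_of n X)"
      using not_forest_imp_cyclic_list[OF pair_graph_graph_of] by blast
    then have "distinct vs" "3 \<le> length vs" "set vs \<subseteq> {1..n}" by (auto simp: cyclic_list_def graph_of_def)
    moreover from this have "length vs \<le> n"
      using card_mono[of "{1..n}" "set vs"] by (simp add: distinct_card)
    moreover have "X \<in> C vs" using cyclic_list_cycle_edges[OF vs(1)] by (simp add: C_def)
    ultimately have "vs \<in> L (length vs)" "length vs \<in> {3..n}" "X \<in> C vs" by (auto simp: L_def)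
    then show "X \<in> (\<Union>k\<in>{3..n}. \<Union>vs\<in>L k. C vs)" by blast
  qed
  then have "measure_pmf.prob (gnp n p) {G. \<not> is_forest G}
      \<le> measure_pmf.prob (edge_pmf n p) (\<Union>k\<in>{3..n}. \<Union>vs\<in>L k. C vs)"
    unfolding prob_gnp by (intro measure_pmf.finite_measure_mono) auto
  also have "\<dots> \<le> (\<Sum>k\<in>{3..n}. measure_pmf.prob (edge_pmf n p) (\<Union>vs\<in>L k. C vs))"
    by (intro measure_UNION_le) auto
  also have "\<dots> \<le> (\<Sum>k\<in>{3..n}. ?c ^ k)"
  proof (rule sum_mono)
    fix k assume k: "k \<in> {3..n}"
    have "measure_pmf.prob (edge_pmf n p) (\<Union>vs\<in>L k. C vs) \<le> (\<Sum>vs\<in>L k. measure_pmf.prob (edge_pmf n p) (C vs))"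
      by (intro measure_UNION_le finL) auto
    also have "\<dots> = (\<Sum>vs\<in>L k. p ^ k)" using k by (intro sum.cong refl probC) auto
    also have "\<dots> = real (card (L k)) * p ^ k" by simp
    also have "\<dots> \<le> real (n ^ k) * p ^ k"
      using assms(1) by (intro mult_right_mono of_nat_mono cardL) auto
    finally show "measure_pmf.prob (edge_pmf n p) (\<Union>vs\<in>L k. C vs) \<le> ?c ^ k"
      by (simp add: power_mult_distrib)
  qed
  also have "\<dots> \<le> (\<Sum>k. ?c ^ (k + 3))"
  proof -
    have "(\<Sum>k\<in>{3..n}. ?c ^ k) \<le> (\<Sum>k<n. ?c ^ (k + 3))"
    proof -
      have "(\<Sum>k\<in>{3..n}. ?c ^ k) \<le> (\<Sum>k\<in>(\<lambda>k. k + 3) ` {..<n}. ?c ^ k)"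
      proof (rule sum_mono2)
        show "{3..n} \<subseteq> (\<lambda>k. k + 3) ` {..<n}"
        proof
          fix k assume "k \<in> {3..n}"
          then show "k \<in> (\<lambda>k. k + 3) ` {..<n}" by (intro image_eqI[of _ _ "k - 3"]) auto
        qed
      qed (use assms(1) in auto)
      then show ?thesis by (simp add: sum.reindex)
    qed
    also have "\<dots> \<le> (\<Sum>k. ?c ^ (k + 3))"
      using assms by (intro sum_le_suminf summable_ignore_initial_segment summable_geometric) auto
    finally show ?thesis .
  qed
  also have "\<dots> = ?c ^ 3 / (1 - ?c)"
  proof -
    have "(\<lambda>k. ?c ^ 3 * ?c ^ k) sums (?c ^ 3 * (1 / (1 - ?c)))"
      using assms by (intro sums_mult geometric_sums) auto
    then show ?thesis by (simp add: power_add mult.commute sums_iff)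
  qed
  finally show ?thesis .
qed

section \<open>Many isolated copies of a tree\<close>

text \<open>
  The pairs whose status decides whether \<open>S\<close> spans a component and which graph it carries.
\<close>

definition touching :: "nat \<Rightarrow> nat set \<Rightarrow> nat set set" where
  "touching n S = {e \<in> pairs_of n. e \<inter> S \<noteq> {}}"

lemma finite_touching [simp]: "finite (touching n S)"
  by (simp add: touching_def)

lemma edges_subset_touching:
  assumes "pair_graph T" "pverts T = S" "S \<subseteq> {1..n}"
  shows "edges T \<subseteq> touching n S" "e \<in> edges T \<Longrightarrow> e \<subseteq> S"
proof -
  have *: "e \<subseteq> S \<and> e \<noteq> {} \<and> card e = 2" if "e \<in> edges T" for e
  proof -
    from that obtain u v where uv: "(u, v) \<in> parcs T" "e = {u, v}" by (auto simp: edges_def)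
    then have "u \<noteq> v" "u \<in> S" "v \<in> S" using assms(1,2) by (auto simp: pair_graph_iff irrefl_def)
    then show ?thesis by (simp add: uv(2))
  qed
  show "edges T \<subseteq> touching n S"
  proof
    fix e assume "e \<in> edges T"
    from *[OF this] show "e \<in> touching n S" using assms(3) by (auto simp: touching_def pairs_of_def)
  qed
  show "e \<in> edges T \<Longrightarrow> e \<subseteq> S" using * by blast
qed

lemma card_touching_le:
  assumes "finite S" "S \<subseteq> {1..n}"
  shows "card (touching n S) \<le> n * card S"
proof -
  have "touching n S \<subseteq> (\<lambda>(x, y). {x, y}) ` (S \<times> {1..n})"
  proof
    fix e assume e: "e \<in> touching n S"
    then obtain x where x: "x \<in> e" "x \<in> S" by (auto simp: touching_def)
    from e have "card e = 2" "e \<subseteq> {1..n}" by (auto simp: touching_def pairs_of_def)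
    then obtain y z where yz: "e = {y, z}" "y \<in> {1..n}" "z \<in> {1..n}" by (auto simp: card_2_iff)
    then have "e = (\<lambda>(x, y). {x, y}) (x, y) \<or> e = (\<lambda>(x, y). {x, y}) (x, z)" using x by auto
    then show "e \<in> (\<lambda>(x, y). {x, y}) ` (S \<times> {1..n})" using x yz(2,3) by blast
  qed
  then have "card (touching n S) \<le> card (S \<times> {1..n})"
    using assms(1) by (meson card_image_le card_mono finite_SigmaI finite_atLeastAtMost finite_imageI le_trans)
  then show ?thesis by (simp add: card_cartesian_product mult.commute)
qed

lemma card_touching_both_le:
  assumes "finite S" "finite S'" "S \<inter> S' = {}"
  shows "card (touching n S \<inter> touching n S') \<le> card S * card S'"
proof -
  have "touching n S \<inter> touching n S' \<subseteq> (\<lambda>(x, y). {x, y}) ` (S \<times> S')"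
  proof
    fix e assume e: "e \<in> touching n S \<inter> touching n S'"
    then obtain x y where xy: "x \<in> e" "x \<in> S" "y \<in> e" "y \<in> S'" by (auto simp: touching_def)
    then have "x \<noteq> y" using assms(3) by auto
    moreover obtain a b where "e = {a, b}" using e by (auto simp: touching_def pairs_of_def card_2_iff)
    ultimately have "e = {x, y}" using xy by auto
    then show "e \<in> (\<lambda>(x, y). {x, y}) ` (S \<times> S')" using xy by auto
  qed
  then have "card (touching n S \<inter> touching n S') \<le> card (S \<times> S')"
    using assms(1,2) by (meson card_image_le card_mono finite_SigmaI finite_imageI le_trans)
  then show ?thesis by (simp add: card_cartesian_product)
qed

definition isolated_copy :: "nat \<Rightarrow> nat pair_pre_digraph \<Rightarrow> (nat set \<Rightarrow> bool) set" where
  "isolated_copy n T = {X. \<forall>e\<in>touching n (pverts T). X e = (e \<in> edges T)}"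

lemma in_edges_iff:
  assumes "pair_graph T"
  shows "{u, v} \<in> edges T \<longleftrightarrow> (u, v) \<in> parcs T"
  using assms by (auto simp: edges_def pair_graph_iff sym_def doubleton_eq_iff)

lemma isolated_copy_component:
  assumes "is_tree T" "pverts T \<subseteq> {1..n}" "X \<in> isolated_copy n T"
  shows "pverts T \<in> components_of (graph_of n X)" "induced_on (graph_of n X) (pverts T) = T"
proof -
  let ?S = "pverts T"
  have pg: "pair_graph T" using assms(1) by (simp add: is_tree_def is_forest_def)
  have T: "parcs T \<subseteq> ?S \<times> ?S" "irrefl (parcs T)" using pg by (auto simp: pair_graph_iff)
  have X: "X {u, v} \<longleftrightarrow> (u, v) \<in> parcs T"
    if "u \<in> {1..n}" "v \<in> {1..n}" "u \<noteq> v" "u \<in> ?S \<or> v \<in> ?S" for u v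
  proof -
    have "{u, v} \<in> touching n ?S" using that by (auto simp: touching_def pairs_of_def)
    then show ?thesis using assms(3) in_edges_iff[OF pg] by (simp add: isolated_copy_def)
  qed
  show *: "induced_on (graph_of n X) ?S = T"
  proof (rule pair_pre_digraph.equality)
    show "pverts (induced_on (graph_of n X) ?S) = pverts T" using assms(2) by (auto simp: graph_of_def)
    have "(u, v) \<in> parcs (induced_on (graph_of n X) ?S) \<longleftrightarrow> (u, v) \<in> parcs T" for u v
    proof (cases "u \<in> ?S \<and> v \<in> ?S \<and> u \<noteq> v")
      case True
      moreover from this have "u \<in> {1..n}" "v \<in> {1..n}" using assms(2) by blast+
      ultimately show ?thesis using X[of u v] by (simp add: graph_of_def)
    next
      case False
      then show ?thesis using T by (auto simp: graph_of_def irrefl_def)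
    qed
    then show "parcs (induced_on (graph_of n X) ?S) = parcs T" by (auto simp del: induced_on_simps)
  qed simp
  show "?S \<in> components_of (graph_of n X)"
  proof (rule component_characterization)
    show "closed_in (graph_of n X) ?S"
      unfolding closed_in_def
    proof clarify
      fix u v assume "(u, v) \<in> parcs (graph_of n X)"
      then have "u \<in> {1..n}" "v \<in> {1..n}" "u \<noteq> v" "X {u, v}" by (auto simp: graph_of_def)
      then show "u \<in> ?S \<longleftrightarrow> v \<in> ?S" using X[of u v] T by blast
    qed
    show "?S \<subseteq> pverts (graph_of n X)" using assms(2) by (simp add: graph_of_def)
  qed (use * assms(1) pair_graph_graph_of in auto)
qed

lemma prob_isolated_copy:
  assumes "pair_graph T" "pverts T \<subseteq> {1..n}" "0 \<le> p" "p \<le> 1"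
  shows "measure_pmf.prob (edge_pmf n p) (isolated_copy n T) =
    (\<Prod>e\<in>touching n (pverts T). if e \<in> edges T then p else 1 - p)"
  unfolding isolated_copy_def
  using assms by (intro prob_edge_pattern) (auto simp: touching_def)

lemma prob_isolated_copy_ge:
  assumes "represents t T r" "pverts T \<subseteq> {1..n}" "0 \<le> p" "p \<le> 1"
  shows "p ^ (leaves t - 1) * (1 - p) ^ (n * leaves t)
    \<le> measure_pmf.prob (edge_pmf n p) (isolated_copy n T)"
proof -
  let ?D = "touching n (pverts T)"
  note T = represents_basic[OF assms(1)]
  have ED: "edges T \<subseteq> ?D" using edges_subset_touching[OF T(2) refl assms(2)] by simp
  have "(\<Prod>e\<in>?D. if e \<in> edges T then p else 1 - p) = p ^ card (edges T) * (1 - p) ^ card (?D - edges T)"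
  proof -
    have "?D = edges T \<union> (?D - edges T)" using ED by auto
    then have "(\<Prod>e\<in>?D. if e \<in> edges T then p else 1 - p) =
        (\<Prod>e\<in>edges T \<union> (?D - edges T). if e \<in> edges T then p else 1 - p)" by simp
    also have "\<dots> = (\<Prod>e\<in>edges T. if e \<in> edges T then p else 1 - p) *
        (\<Prod>e\<in>?D - edges T. if e \<in> edges T then p else 1 - p)"
      using finite_subset[OF ED] by (intro prod.union_disjoint) auto
    finally show ?thesis by simp
  qed
  moreover have "p ^ (leaves t - 1) \<le> p ^ card (edges T)"
    using T(4) assms(3,4) by (intro power_decreasing) auto
  moreover have "(1 - p) ^ (n * leaves t) \<le> (1 - p) ^ card (?D - edges T)"
  proof (rule power_decreasing)
    have "card (?D - edges T) \<le> card ?D" by (intro card_mono) auto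
    also have "\<dots> \<le> n * leaves t"
      using card_touching_le[OF _ assms(2)] T(2,3) by (simp add: pair_graph_iff)
    finally show "card (?D - edges T) \<le> n * leaves t" .
  qed (use assms in auto)
  ultimately show ?thesis
    using prob_isolated_copy[OF T(2) assms(2-4)] assms(3,4) by (auto intro!: mult_mono)
qed

text \<open>
  Copies on two distinct vertex sets that meet cannot both be components. For disjoint vertex sets, the
  two events prescribe the status of pairs of which at most \<open>m\<^sup>2\<close>, those that join the two
  sets, are common to both and absent in both. So the probability of the intersection exceeds the
  product of the probabilities at most by the factor \<open>(1 - p)\<close> to the power \<open>- m\<^sup>2\<close>.
\<close>

lemma prob_two_isolated_copies:
  assumes "is_tree T" "is_tree T'" "pverts T \<subseteq> {1..n}" "pverts T' \<subseteq> {1..n}"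
    and "card (pverts T) = m" "card (pverts T') = m" "pverts T \<noteq> pverts T'"
    and p: "0 \<le> p" "p \<le> 1" "real m ^ 2 * p \<le> 1 / 2"
  shows "measure_pmf.prob (edge_pmf n p) (isolated_copy n T \<inter> isolated_copy n T')
    \<le> (1 + 2 * (real m ^ 2 * p)) *
      (measure_pmf.prob (edge_pmf n p) (isolated_copy n T) * measure_pmf.prob (edge_pmf n p) (isolated_copy n T'))"
proof (cases "pverts T \<inter> pverts T' = {}")
  case False
  have "isolated_copy n T \<inter> isolated_copy n T' = {}"
  proof (rule ccontr)
    assume "isolated_copy n T \<inter> isolated_copy n T' \<noteq> {}"
    then obtain X where X: "X \<in> isolated_copy n T" "X \<in> isolated_copy n T'" by blast
    have "pverts T \<in> components_of (graph_of n X)" "pverts T' \<in> components_of (graph_of n X)"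
      using isolated_copy_component(1)[OF assms(1,3) X(1)] isolated_copy_component(1)[OF assms(2,4) X(2)] .
    moreover have "disjoint (components_of (graph_of n X))"
      using closed_partition_components[OF pair_graph_graph_of] by (auto simp: closed_partition_def)
    ultimately show False using assms(7) False by (auto simp: disjoint_def pairwise_def disjnt_def)
  qed
  then show ?thesis using p by simp
next
  case True
  have pg: "pair_graph T" "pair_graph T'" using assms(1,2) by (auto simp: is_tree_def is_forest_def)
  let ?D = "touching n (pverts T)" and ?D' = "touching n (pverts T')"
  let ?g = "\<lambda>e. e \<in> edges T \<or> e \<in> edges T'"
  let ?w = "\<lambda>e. if ?g e then p else 1 - p"
  note sub = edges_subset_touching[OF pg(1) refl assms(3)] edges_subset_touching[OF pg(2) refl assms(4)]
  have 1: "e \<in> edges T \<longleftrightarrow> ?g e" if "e \<in> ?D" for e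
    using that sub(4)[of e] True by (auto simp: touching_def)
  have 2: "e \<in> edges T' \<longleftrightarrow> ?g e" if "e \<in> ?D'" for e
    using that sub(2)[of e] True by (auto simp: touching_def)
  have "isolated_copy n T \<inter> isolated_copy n T' = {X. \<forall>e\<in>?D \<union> ?D'. X e = ?g e}"
    using 1 2 unfolding isolated_copy_def by blast
  then have both: "measure_pmf.prob (edge_pmf n p) (isolated_copy n T \<inter> isolated_copy n T') = prod ?w (?D \<union> ?D')"
    using prob_edge_pattern[of "?D \<union> ?D'" n p ?g] p by (auto simp: touching_def)
  have q: "measure_pmf.prob (edge_pmf n p) (isolated_copy n T) = prod ?w ?D"
      "measure_pmf.prob (edge_pmf n p) (isolated_copy n T') = prod ?w ?D'"
    unfolding prob_isolated_copy[OF pg(1) assms(3) p(1,2)] prob_isolated_copy[OF pg(2) assms(4) p(1,2)]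
    using 1 2 by (auto intro!: prod.cong)
  \<comment> \<open>a common pair meets both vertex sets, hence belongs to neither tree\<close>
  have inter: "prod ?w (?D \<inter> ?D') = (1 - p) ^ card (?D \<inter> ?D')"
  proof -
    have "\<not> ?g e" if "e \<in> ?D \<inter> ?D'" for e
      using that sub(2,4)[of e] True by (auto simp: touching_def)
    then show ?thesis by simp
  qed
  have "1 - real m ^ 2 * p \<le> (1 - p) ^ (m * m)"
    using Bernoulli_inequality[of "- p" "m * m"] p by (simp add: power2_eq_square mult.assoc)
  also have "\<dots> \<le> (1 - p) ^ card (?D \<inter> ?D')"
  proof (rule power_decreasing)
    show "card (?D \<inter> ?D') \<le> m * m"
      using card_touching_both_le[OF _ _ True, of n] pg assms(5,6) by (simp add: pair_graph_iff)
  qed (use p in auto)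
  finally have ge: "1 - real m ^ 2 * p \<le> prod ?w (?D \<inter> ?D')" by (simp add: inter)
  have w0: "0 \<le> prod ?w B" for B using p by (intro prod_nonneg) auto
  have "prod ?w (?D \<union> ?D') * prod ?w (?D \<inter> ?D') = prod ?w ?D * prod ?w ?D'"
    by (intro prod.union_inter) auto
  then have le: "prod ?w (?D \<union> ?D') * (1 - real m ^ 2 * p) \<le> prod ?w ?D * prod ?w ?D'"
    using mult_left_mono[OF ge w0[of "?D \<union> ?D'"]] by simp
  define x where "x = real m ^ 2 * p"
  have x: "0 \<le> x" "x \<le> 1 / 2" using p by (auto simp: x_def)
  \<comment> \<open>\<open>1 / (1 - x) \<le> 1 + 2x\<close> for \<open>0 \<le> x \<le> 1/2\<close>\<close>
  have "1 \<le> (1 - x) * (1 + 2 * x)"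
  proof -
    have "0 \<le> x * (1 - 2 * x)" using x by (intro mult_nonneg_nonneg) auto
    then show ?thesis by (simp add: algebra_simps)
  qed
  then have "prod ?w (?D \<union> ?D') * 1 \<le> prod ?w (?D \<union> ?D') * ((1 - x) * (1 + 2 * x))"
    using w0 by (intro mult_left_mono) auto
  also have "\<dots> \<le> (prod ?w ?D * prod ?w ?D') * (1 + 2 * x)"
    using le x unfolding x_def[symmetric] by (simp add: mult_right_mono flip: mult.assoc)
  finally show ?thesis unfolding both q x_def by (simp add: mult.commute)
qed

text \<open>
  On each vertex set of the right size one fixed copy of the shape is looked for. This loses a factor
  of at most the factorial of \<open>m\<close> in the expectation, where \<open>m\<close> is the size, but makes the events easy to describe.
\<close>

lemma prob_few_isolated_copies_le:
  assumes p: "0 \<le> p" "p \<le> 1" "real (leaves t) ^ 2 * p \<le> 1 / 2"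
    and \<mu>: "\<mu>\<^sub>0 \<le> real (n choose leaves t) * (p ^ (leaves t - 1) * (1 - p) ^ (n * leaves t))"
      "2 * real K < \<mu>\<^sub>0"
  shows "measure_pmf.prob (gnp n p)
      {G. card {C \<in> components_of G. \<exists>r. represents t (induced_on G C) r} < K}
    \<le> 4 / \<mu>\<^sub>0 + 8 * (real (leaves t) ^ 2 * p)"
proof -
  let ?m = "leaves t"
  define I where "I = {S. S \<subseteq> {1..n} \<and> card S = ?m}"
  have finI: "finite I" and cardI: "card I = n choose ?m"
    unfolding I_def using n_subsets[of "{1..n}" ?m] by (auto intro: finite_subset[of _ "Pow {1..n}"])
  have "\<forall>S\<in>I. \<exists>T r. represents t (T :: nat pair_pre_digraph) r \<and> pverts T = S"
  proof
    fix S assume "S \<in> I"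
    then have "finite S" "card S = ?m" by (auto simp: I_def intro: finite_subset)
    from represents_on_set[OF this] show "\<exists>T r. represents t (T :: nat pair_pre_digraph) r \<and> pverts T = S" .
  qed
  then obtain T R where T: "\<And>S. S \<in> I \<Longrightarrow> represents t (T S :: nat pair_pre_digraph) (R S)"
      "\<And>S. S \<in> I \<Longrightarrow> pverts (T S) = S" by metis
  have tree: "is_tree (T S)" if "S \<in> I" for S using T(1)[OF that] by (rule represents_is_tree)
  define A where "A = (\<lambda>S. isolated_copy n (T S))"
  define \<mu>' where "\<mu>' = (\<Sum>S\<in>I. measure_pmf.prob (edge_pmf n p) (A S))"
  define \<delta> where "\<delta> = 2 * (real ?m ^ 2 * p)"
  have \<delta>: "0 \<le> \<delta>" using p by (simp add: \<delta>_def)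
  have "real (card I) * (p ^ (?m - 1) * (1 - p) ^ (n * ?m)) \<le> \<mu>'"
  proof -
    have "(\<Sum>S\<in>I. p ^ (?m - 1) * (1 - p) ^ (n * ?m)) \<le> \<mu>'"
      unfolding \<mu>'_def A_def
    proof (rule sum_mono)
      fix S assume S: "S \<in> I"
      then show "p ^ (?m - 1) * (1 - p) ^ (n * ?m)
          \<le> measure_pmf.prob (edge_pmf n p) (isolated_copy n (T S))"
        using T[OF S] p by (intro prob_isolated_copy_ge[of t _ "R S"]) (auto simp: I_def)
    qed
    then show ?thesis by simp
  qed
  then have \<mu>': "\<mu>\<^sub>0 \<le> \<mu>'" using \<mu>(1) by (simp add: cardI)
  then have K: "2 * real K < \<mu>'" "0 < \<mu>'" "0 < \<mu>\<^sub>0" using \<mu>(2) by auto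
  have "measure_pmf.prob (gnp n p)
      {G. card {C \<in> components_of G. \<exists>r. represents t (induced_on G C) r} < K}
    \<le> measure_pmf.prob (edge_pmf n p) {X. card {S \<in> I. X \<in> A S} < K}"
    unfolding prob_gnp
  proof (intro measure_pmf.finite_measure_mono subsetI CollectI)
    fix X
    let ?C = "{C \<in> components_of (graph_of n X). \<exists>r. represents t (induced_on (graph_of n X) C) r}"
    assume "X \<in> {X. card {C \<in> components_of (graph_of n X). \<exists>r. represents t (induced_on (graph_of n X) C) r} < K}"
    then have less: "card ?C < K" by simp
    have "{S \<in> I. X \<in> A S} \<subseteq> ?C"
    proof clarify
      fix S assume S: "S \<in> I" "X \<in> A S"
      then have "pverts (T S) \<subseteq> {1..n}" using T by (auto simp: I_def)
      from isolated_copy_component[OF tree[OF S(1)] this, of X] S T(1)[OF S(1)]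
      show "S \<in> components_of (graph_of n X) \<and> (\<exists>r. represents t (induced_on (graph_of n X) S) r)"
        by (auto simp: A_def T(2)[OF S(1)])
    qed
    moreover have "finite ?C"
      using closed_partition_components[OF pair_graph_graph_of] by (auto simp: closed_partition_def)
    ultimately show "card {S \<in> I. X \<in> A S} < K" using card_mono less by (meson le_less_trans)
  qed auto
  also have "\<dots> \<le> (\<mu>' + \<delta> * \<mu>'\<^sup>2) / (\<mu>' - K)\<^sup>2"
  proof (rule prob_few_events_le[OF finI \<delta>])
    fix S S' assume S: "S \<in> I" "S' \<in> I" "S \<noteq> S'"
    then show "measure_pmf.prob (edge_pmf n p) (A S \<inter> A S') \<le>
        (1 + \<delta>) * (measure_pmf.prob (edge_pmf n p) (A S) * measure_pmf.prob (edge_pmf n p) (A S'))"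
      unfolding A_def \<delta>_def using p T(2) tree
      by (intro prob_two_isolated_copies[where m = ?m]) (auto simp: I_def)
  qed (use \<mu>'_def K in auto)
  \<comment> \<open>\<open>K\<close> is at most half of the mean\<close>
  also have "\<dots> \<le> (\<mu>' + \<delta> * \<mu>'\<^sup>2) / (\<mu>' / 2)\<^sup>2"
    using K \<delta> by (intro divide_left_mono power_mono mult_pos_pos) auto
  also have "\<dots> = 4 / \<mu>' + 4 * \<delta>"
    using K(2) by (simp add: field_simps power2_eq_square)
  also have "\<dots> \<le> 4 / \<mu>\<^sub>0 + 4 * \<delta>"
    using \<mu>' K by (simp add: frac_le)
  finally show ?thesis by (simp add: \<delta>_def)
qed

section \<open>Asymptotics in the pruning regime\<close>

text \<open>
  By \<open>(n/m)\<^sup>m \<le> n choose m\<close> and \<open>1 - p \<ge> exp (- 2p)\<close>, the logarithm of the expected number of copies is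
  at least \<open>ln n - m (ln m + ln (1/c) + 2)\<close>.
\<close>

lemma copy_expectation_ge:
  fixes c :: real
  assumes m: "1 \<le> m" "m \<le> n" and c: "0 < c" "c \<le> 1 / 2"
    and b: "real m * (ln (real m) + ln (1 / c) + 2) \<le> ln (real n) / 2"
  shows "sqrt (real n) \<le> real (n choose m) * ((c / n) ^ (m - 1) * (1 - c / n) ^ (n * m))"
proof -
  have n: "1 \<le> n" using m by simp
  let ?p = "c / real n"
  have p: "0 < ?p" "?p \<le> 1 / 2"
  proof -
    have "c \<le> 1 / 2 * real n" using c n by (intro order_trans[OF c(2)]) simp
    then show "?p \<le> 1 / 2" using n by (simp add: field_simps)
  qed (use c n in auto)
  have lnc: "ln c = - ln (1 / c)" using c by (simp add: ln_div)
  have l0: "0 \<le> ln (1 / c)" using c by simp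
  have e1: "exp (real m * (ln n - ln m)) = (real n / real m) ^ m"
    using m n by (simp add: exp_of_nat_mult exp_diff)
  have e2: "exp (real (m - 1) * (ln c - ln n)) = ?p ^ (m - 1)"
    using c n by (simp add: exp_of_nat_mult exp_diff)
  have e3: "exp (- (2 * c * m)) \<le> (1 - ?p) ^ (n * m)"
  proof -
    have "?p\<^sup>2 \<le> ?p * (1 / 2)" using p unfolding power2_eq_square by (intro mult_left_mono) auto
    then have "- (2 * ?p) \<le> ln (1 - ?p)"
      using ln_one_minus_pos_lower_bound[of ?p] p by simp
    then have "exp (- (2 * ?p)) \<le> 1 - ?p" using p by (simp add: ln_ge_iff)
    then have "exp (- (2 * ?p)) ^ (n * m) \<le> (1 - ?p) ^ (n * m)" by (intro power_mono) auto
    also have "exp (- (2 * ?p)) ^ (n * m) = exp (- (2 * c * m))"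
      using n by (simp add: exp_of_nat_mult[symmetric])
    finally show ?thesis .
  qed
  have "ln n / 2 \<le> real m * (ln n - ln m) + (real (m - 1) * (ln c - ln n) + - (2 * c * m))"
  proof -
    have "2 * c * m \<le> 2 * real m" using c by (intro mult_right_mono) auto
    moreover have "(real m - 1) * ln (1 / c) \<le> real m * ln (1 / c)" using l0 by (intro mult_right_mono) auto
    moreover have "real m * ln m + real m * ln (1 / c) + real m * 2 \<le> ln n / 2"
      using b by (simp only: distrib_left)
    moreover have "real m * (ln n - ln m) + (real (m - 1) * (ln c - ln n) + - (2 * c * m))
        = ln n - real m * ln m - (real m - 1) * ln (1 / c) - 2 * c * m"
      using m(1) unfolding lnc by (simp add: algebra_simps of_nat_diff)
    ultimately show ?thesis by linarith
  qed
  then have "exp (ln n / 2) \<le> exp (real m * (ln n - ln m)) * (exp (real (m - 1) * (ln c - ln n)) * exp (- (2 * c * m)))"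
    by (simp add: exp_add[symmetric])
  also have "\<dots> \<le> real (n choose m) * (?p ^ (m - 1) * (1 - ?p) ^ (n * m))"
    unfolding e1 e2 using binomial_ge_n_over_k_pow_k[OF m(2), where 'a = real] p e3
    by (intro mult_mono mult_nonneg_nonneg) auto
  also have "exp (ln n / 2) = sqrt n"
    using n by (simp add: ln_sqrt[symmetric])
  finally show ?thesis .
qed

text \<open>
  The summand \<open>2\<close> and the increase of \<open>f n\<close> by a constant \<open>L\<close> are absorbed by \<open>ln (1 / c n)\<close>, which
  tends to infinity, and by a constant factor, which the little-o condition allows.
\<close>

lemma pruning_regime_eventually:
  assumes "pruning_regime c f"
  shows "\<forall>\<^sub>F n in sequentially. \<forall>m. f n \<le> m \<and> m \<le> f n + L \<longrightarrow>
    0 \<le> c n / n \<and> c n / n \<le> 1 \<and> real m ^ 2 * (c n / n) \<le> (ln n)\<^sup>2 / n \<and>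
    sqrt n \<le> real (n choose m) * ((c n / n) ^ (m - 1) * (1 - c n / n) ^ (n * m))"
proof -
  let ?a = "\<lambda>n. real (f n) * (ln (real (f n)) + ln (1 / c n))"
  have c: "\<And>n. 1 \<le> n \<Longrightarrow> 0 < c n" "c \<longlonglongrightarrow> 0" and f: "\<And>n. 1 \<le> n \<Longrightarrow> 1 \<le> f n"
    and a: "?a \<in> o(\<lambda>n. ln (real n))"
    using assms by (auto simp: pruning_regime_def)
  have "0 < 1 / (4 * (1 + real L))" by simp
  from landau_o.smallD[OF a this]
  have "\<forall>\<^sub>F n in sequentially. norm (?a n) \<le> 1 / (4 * (1 + real L)) * norm (ln (real n))" .
  moreover have "\<forall>\<^sub>F n in sequentially. c n < exp (- (ln (1 + real L) + 2))"
    using c(2) by (rule order_tendstoD) simp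
  moreover have "\<forall>\<^sub>F n in sequentially. c n < 1 / 2"
    using c(2) by (rule order_tendstoD) simp
  ultimately show ?thesis
    using eventually_ge_at_top[of 1]
  proof eventually_elim
    case (elim n)
    have cn: "0 < c n" "1 \<le> f n" using c(1) f elim(4) by auto
    define F where "F = real (f n)"
    define l where "l = ln (1 / c n)"
    have F: "1 \<le> F" "0 \<le> ln F" using cn by (auto simp: F_def)
    have "ln (c n) < - (ln (1 + real L) + 2)"
      using elim(2) cn(1) by (metis exp_gt_zero ln_exp ln_less_cancel_iff)
    then have l: "ln (1 + real L) + 2 \<le> l" using cn(1) by (simp add: l_def ln_div)
    have "0 \<le> ln (1 + real L)" by simp
    then have l0: "2 \<le> l" using l by linarith
    have lnn: "0 \<le> ln (real n)" using elim(4) by simp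
    have "F * (ln F + l) \<le> \<bar>?a n\<bar>" by (simp add: F_def l_def)
    also have "\<dots> \<le> 1 / (4 * (1 + real L)) * ln n" using elim(1) lnn by simp
    finally have aF: "2 * ((1 + real L) * (F * (ln F + l))) \<le> ln n / 2" by (simp add: field_simps)
    show ?case
    proof (intro allI impI)
      fix m assume m: "f n \<le> m \<and> m \<le> f n + L"
      have m1: "1 \<le> m" using m cn by simp
      have "real m \<le> F + real L" using m by (simp add: F_def)
      also have "\<dots> \<le> (1 + real L) * F"
      proof -
        have "real L * 1 \<le> real L * F" using F by (intro mult_left_mono) auto
        then show ?thesis by (simp add: algebra_simps)
      qed
      finally have mF: "real m \<le> (1 + real L) * F" .
      then have "ln (real m) \<le> ln ((1 + real L) * F)" using m1 F by simp
      also have "\<dots> = ln (1 + real L) + ln F" using F by (simp add: ln_mult)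
      finally have lnm: "ln (real m) \<le> ln (1 + real L) + ln F" .
      have "ln (real m) + l + 2 \<le> (ln (1 + real L) + 2) + (ln F + l)" using lnm by simp
      also have "\<dots> \<le> l + (ln F + l)" using l by (rule add_right_mono)
      also have "\<dots> \<le> 2 * (ln F + l)" using F(2) by simp
      finally have "ln (real m) + l + 2 \<le> 2 * (ln F + l)" .
      then have "real m * (ln (real m) + l + 2) \<le> ((1 + real L) * F) * (2 * (ln F + l))"
        using mF F l0 m1 by (intro mult_mono) auto
      also have "\<dots> = 2 * ((1 + real L) * (F * (ln F + l)))" by simp
      also have "\<dots> \<le> ln n / 2" by (rule aF)
      finally have b: "real m * (ln (real m) + l + 2) \<le> ln n / 2" .
      have "real m * 1 \<le> real m * (ln (real m) + l + 2)" using l0 m1 by (intro mult_left_mono) auto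
      then have mln: "real m \<le> ln n" using b lnn by simp
      also have "ln n \<le> real n - 1" using elim(4) by (intro ln_le_minus_one) auto
      finally have mn: "m \<le> n" by simp
      have "c n * 1 \<le> c n * real n" using cn elim(4) by (intro mult_left_mono) auto
      then have p1: "c n / n \<le> 1" using elim(3,4) by (simp add: field_simps)
      have "real m ^ 2 * c n \<le> (ln n) ^ 2 * 1"
        using mln cn elim(3) by (intro mult_mono power_mono) auto
      then have "real m ^ 2 * (c n / n) \<le> (ln n)\<^sup>2 / n"
        using elim(4) by (simp add: divide_right_mono)
      then show "0 \<le> c n / n \<and> c n / n \<le> 1 \<and> real m ^ 2 * (c n / n) \<le> (ln n)\<^sup>2 / n \<and>
          sqrt n \<le> real (n choose m) * ((c n / n) ^ (m - 1) * (1 - c n / n) ^ (n * m))"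
        using copy_expectation_ge[OF m1 mn cn(1)] elim(3) b cn p1 by (simp add: l_def)
    qed
  qed
qed

section \<open>Events that hold with probability tending to one\<close>

lemma whp_iff: "whp H P \<longleftrightarrow> (\<lambda>n. measure_pmf.prob (H n) {G. \<not> P G}) \<longlonglongrightarrow> 0"
proof -
  have "measure_pmf.prob (H n) {G. \<not> P G} = 1 - measure_pmf.prob (H n) {G. P G}" for n
    using measure_pmf.prob_compl[of "{G. P G}" "H n"] by (simp add: Compl_eq set_diff_eq)
  then have eq: "(\<lambda>n. measure_pmf.prob (H n) {G. \<not> P G}) = (\<lambda>n. 1 - measure_pmf.prob (H n) {G. P G})"
    by auto
  show ?thesis unfolding whp_def eq
    using tendsto_diff[OF tendsto_const[of "1 :: real"], of "\<lambda>n. measure_pmf.prob (H n) {G. P G}" 1 sequentially]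
      tendsto_diff[OF tendsto_const[of "1 :: real"], of "\<lambda>n. 1 - measure_pmf.prob (H n) {G. P G}" 0 sequentially]
    by auto
qed

lemma whpI:
  assumes "\<forall>\<^sub>F n in sequentially. measure_pmf.prob (H n) {G. \<not> P G} \<le> e n" "e \<longlonglongrightarrow> 0"
  shows "whp H P"
  unfolding whp_iff using assms by (intro tendsto_sandwich[OF _ assms(1) tendsto_const assms(2)]) auto

lemma whp_mono:
  assumes "whp H P" "\<And>G. P G \<Longrightarrow> Q G"
  shows "whp H Q"
proof (rule whpI)
  show "\<forall>\<^sub>F n in sequentially. measure_pmf.prob (H n) {G. \<not> Q G} \<le> measure_pmf.prob (H n) {G. \<not> P G}"
    using assms(2) by (intro always_eventually allI measure_pmf.finite_measure_mono) auto
qed (use assms(1) in \<open>simp add: whp_iff\<close>)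

lemma whp_conj:
  assumes "whp H P" "whp H Q"
  shows "whp H (\<lambda>G. P G \<and> Q G)"
proof (rule whpI)
  show "\<forall>\<^sub>F n in sequentially. measure_pmf.prob (H n) {G. \<not> (P G \<and> Q G)} \<le>
      measure_pmf.prob (H n) {G. \<not> P G} + measure_pmf.prob (H n) {G. \<not> Q G}"
  proof (intro always_eventually allI)
    fix n
    have "{G. \<not> (P G \<and> Q G)} = {G. \<not> P G} \<union> {G. \<not> Q G}" by auto
    then show "measure_pmf.prob (H n) {G. \<not> (P G \<and> Q G)} \<le>
        measure_pmf.prob (H n) {G. \<not> P G} + measure_pmf.prob (H n) {G. \<not> Q G}"
      using measure_Un_le[of "{G. \<not> P G}" "H n" "{G. \<not> Q G}"] by simp
  qed
  show "(\<lambda>n. measure_pmf.prob (H n) {G. \<not> P G} + measure_pmf.prob (H n) {G. \<not> Q G}) \<longlonglongrightarrow> 0"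
    using tendsto_add[of "\<lambda>n. measure_pmf.prob (H n) {G. \<not> P G}" 0 sequentially
        "\<lambda>n. measure_pmf.prob (H n) {G. \<not> Q G}" 0] assms by (simp add: whp_iff)
qed

lemma whp_finite_ball:
  assumes "finite A" "\<And>a. a \<in> A \<Longrightarrow> whp H (P a)"
  shows "whp H (\<lambda>G. \<forall>a\<in>A. P a G)"
  using assms
proof (induction A rule: finite_induct)
  case empty
  then show ?case by (simp add: whp_iff)
next
  case (insert a A)
  then show ?case using whp_conj[of H "P a" "\<lambda>G. \<forall>a\<in>A. P a G"] by simp
qed

lemma whp_satisfiable:
  assumes "whp H P"
  shows "\<exists>G. P G"
proof (rule ccontr)
  assume "\<nexists>G. P G"
  then have "(\<lambda>n. 0 :: real) \<longlonglongrightarrow> 1" using assms by (simp add: whp_def)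
  then show False by (simp add: LIMSEQ_const_iff)
qed

section \<open>The pruned random graph\<close>

lemma prob_pruned_gnp:
  "measure_pmf.prob (pruned_gnp c f n) {G. Q G} =
   measure_pmf.prob (edge_pmf n (c n / n)) {X. Q (prune (f n) (graph_of n X))}"
  by (simp add: pruned_gnp_def gnp_eq vimage_def)

lemma whp_pruned_is_forest:
  assumes "pruning_regime c f"
  shows "whp (pruned_gnp c f) is_forest"
proof (rule whpI)
  have c: "\<And>n. 1 \<le> n \<Longrightarrow> 0 < c n" "c \<longlonglongrightarrow> 0" using assms by (auto simp: pruning_regime_def)
  have "\<forall>\<^sub>F n in sequentially. c n < 1" using c(2) by (rule order_tendstoD) simp
  then show "\<forall>\<^sub>F n in sequentially. measure_pmf.prob (pruned_gnp c f n) {G. \<not> is_forest G} \<le> (c n) ^ 3 / (1 - c n)"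
    using eventually_ge_at_top[of 1]
  proof eventually_elim
    case (elim n)
    have "measure_pmf.prob (pruned_gnp c f n) {G. \<not> is_forest G}
        \<le> measure_pmf.prob (gnp n (c n / n)) {G. \<not> is_forest G}"
      unfolding prob_pruned_gnp prob_gnp
      using is_forest_prune by (intro measure_pmf.finite_measure_mono) auto
    also have "\<dots> \<le> (real n * (c n / n)) ^ 3 / (1 - real n * (c n / n))"
      using elim c(1)[of n] by (intro prob_not_forest_le) auto
    finally show ?case using elim by simp
  qed
  have "(\<lambda>n. (c n) ^ 3 / (1 - c n)) \<longlonglongrightarrow> 0 ^ 3 / (1 - 0)"
    using c(2) by (intro tendsto_intros) auto
  then show "(\<lambda>n. (c n) ^ 3 / (1 - c n)) \<longlonglongrightarrow> 0" by simp
qed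

lemma num_components_prune_ge:
  assumes "pair_graph G" "m \<le> leaves t"
    and "\<And>(T :: nat pair_pre_digraph) r. represents t T r \<Longrightarrow> T \<in> \<tau>"
  shows "card {C \<in> components_of G. \<exists>r. represents t (induced_on G C) r} \<le> num_components \<tau> (prune m G)"
  unfolding num_components_def
proof (rule card_mono)
  show "finite {C \<in> components_of (prune m G). induced_on (prune m G) C \<in> \<tau>}"
    using closed_partition_components[OF prune_props(1)[OF assms(1), of m]]
    by (auto simp: closed_partition_def)
  show "{C \<in> components_of G. \<exists>r. represents t (induced_on G C) r}
      \<subseteq> {C \<in> components_of (prune m G). induced_on (prune m G) C \<in> \<tau>}"
  proof clarify
    fix C r assume C: "C \<in> components_of G" "represents t (induced_on G C) r"
    then have "C \<subseteq> pverts G"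
      using closed_partition_components[OF assms(1)] by (auto simp: closed_partition_def)
    then have "card C = leaves t"
      using represents_basic(3)[OF C(2)] by (simp add: Int_absorb1)
    then have "C \<in> components_of (prune m G)"
      using C(1) assms(2) by (simp add: prune_props(2)[OF assms(1)])
    moreover from prune_props(3)[OF assms(1) this] have "induced_on (prune m G) C \<in> \<tau>"
      using assms(3)[OF C(2)] by simp
    ultimately show "C \<in> components_of (prune m G) \<and> induced_on (prune m G) C \<in> \<tau>" ..
  qed
qed

lemma whp_many_components:
  assumes "pruning_regime c f" "\<tau> \<in> component_types s" "unbounded_type \<tau>"
  shows "whp (pruned_gnp c f) (\<lambda>G. K \<le> num_components \<tau> G)"
proof (rule whpI)
  obtain L where "\<forall>N. \<exists>t. N \<le> leaves t \<and> leaves t \<le> N + L \<and>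
      (\<forall>(G :: nat pair_pre_digraph) r. represents t G r \<longrightarrow> G \<in> \<tau>)"
    using unbounded_type_shapes[OF assms(2,3)] by blast
  then obtain t where t: "\<And>N. N \<le> leaves (t N)" "\<And>N. leaves (t N) \<le> N + L"
      "\<And>N (G :: nat pair_pre_digraph) r. represents (t N) G r \<Longrightarrow> G \<in> \<tau>" by metis
  have "\<forall>\<^sub>F n in sequentially. (ln (real n))\<^sup>2 / real n \<le> 1 / 2" by real_asymp
  moreover have "\<forall>\<^sub>F n in sequentially. 2 * real K < sqrt (real n)" by real_asymp
  ultimately show "\<forall>\<^sub>F n in sequentially. measure_pmf.prob (pruned_gnp c f n) {G. \<not> K \<le> num_components \<tau> G}
      \<le> 4 / sqrt (real n) + 8 * ((ln (real n))\<^sup>2 / real n)"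
    using pruning_regime_eventually[OF assms(1), of L]
  proof eventually_elim
    case (elim n)
    let ?t = "t (f n)" and ?p = "c n / n"
    have p: "0 \<le> ?p" "?p \<le> 1" "real (leaves ?t) ^ 2 * ?p \<le> (ln n)\<^sup>2 / n"
        "sqrt n \<le> real (n choose leaves ?t) * (?p ^ (leaves ?t - 1) * (1 - ?p) ^ (n * leaves ?t))"
      using elim(3) t(1,2)[of "f n"] by auto
    have "measure_pmf.prob (pruned_gnp c f n) {G. \<not> K \<le> num_components \<tau> G}
      \<le> measure_pmf.prob (gnp n ?p)
        {G. card {C \<in> components_of G. \<exists>r. represents ?t (induced_on G C) r} < K}"
      unfolding prob_pruned_gnp prob_gnp
    proof (intro measure_pmf.finite_measure_mono subsetI CollectI)
      fix X assume "X \<in> {X. \<not> K \<le> num_components \<tau> (prune (f n) (graph_of n X))}"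
      then show "card {C \<in> components_of (graph_of n X). \<exists>r. represents ?t (induced_on (graph_of n X) C) r} < K"
        using num_components_prune_ge[OF pair_graph_graph_of[of n X] t(1)[of "f n"] t(3)[of "f n"]] by force
    qed auto
    also have "\<dots> \<le> 4 / sqrt n + 8 * (real (leaves ?t) ^ 2 * ?p)"
      using p order_trans[OF p(3) elim(1)] elim(2) by (intro prob_few_isolated_copies_le) auto
    also have "\<dots> \<le> 4 / sqrt n + 8 * ((ln n)\<^sup>2 / n)" using p(3) by simp
    finally show ?case .
  qed
  show "(\<lambda>n. 4 / sqrt (real n) + 8 * ((ln (real n))\<^sup>2 / real n)) \<longlonglongrightarrow> 0" by real_asymp
qed

definition unbounded_types :: "nat \<Rightarrow> nat pair_pre_digraph set set" where
  "unbounded_types s = {\<tau> \<in> component_types s. unbounded_type \<tau>}"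

text \<open>
  The three properties have different reasons: there are no cycles by the union bound, components are
  large by the definition of pruning, and all types occur often by the second moment bound.
\<close>

lemma whp_large_component_forest:
  assumes "pruning_regime c f"
  shows "whp (pruned_gnp c f) (\<lambda>G. G \<in> large_component_forests B M (unbounded_types s))"
proof -
  have "whp (pruned_gnp c f) (\<lambda>G. \<forall>C\<in>components_of G. \<not> card C \<le> B)"
  proof (rule whpI)
    have "filterlim f at_top sequentially" using assms by (simp add: pruning_regime_def)
    then have "\<forall>\<^sub>F n in sequentially. Suc B \<le> f n" by (simp add: filterlim_at_top)
    then show "\<forall>\<^sub>F n in sequentially.
        measure_pmf.prob (pruned_gnp c f n) {G. \<not> (\<forall>C\<in>components_of G. \<not> card C \<le> B)} \<le> 0"
    proof eventually_elim
      case (elim n)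
      have "{X. \<not> (\<forall>C\<in>components_of (prune (f n) (graph_of n X)). \<not> card C \<le> B)} = {}"
        using elim by (auto simp: prune_props(2)[OF pair_graph_graph_of])
      then show ?case unfolding prob_pruned_gnp by simp
    qed
  qed simp
  moreover have "whp (pruned_gnp c f) (\<lambda>G. \<forall>\<tau>\<in>unbounded_types s. M \<le> num_components \<tau> G)"
    using whp_many_components[OF assms] finite_component_types[of s]
    by (intro whp_finite_ball) (auto simp: unbounded_types_def)
  ultimately show ?thesis
    using whp_conj[OF whp_pruned_is_forest[OF assms] whp_conj] by (simp add: large_component_forests_def)
qed

section \<open>The common theory of forests with large components\<close>

lemma pverts_induced_on_component:
  assumes "pair_graph G" "C \<in> components_of G"
  shows "pverts (induced_on G C) = C"
  using assms closed_partition_components[OF assms(1)] by (auto simp: closed_partition_def)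

lemma no_bounded_components:
  assumes "\<forall>\<tau>\<in>component_types s. \<not> unbounded_type \<tau> \<longrightarrow> (\<forall>A\<in>\<tau>. card (pverts A) \<le> B)"
    and "F \<in> large_component_forests B M \<Gamma>" "C \<in> components_of F"
    and "\<tau> \<in> component_types s" "induced_on F C \<in> \<tau>"
  shows "unbounded_type \<tau>"
proof (rule ccontr)
  assume "\<not> unbounded_type \<tau>"
  then have "card (pverts (induced_on F C)) \<le> B" using assms by blast
  moreover have "pair_graph F" using assms(2) by (simp add: large_component_forests_def is_forest_def)
  ultimately have "card C \<le> B" by (simp add: pverts_induced_on_component[OF _ assms(3)] del: induced_on_simps)
  then show False using assms(2,3) by (auto simp: large_component_forests_def)
qed

text \<open>
  Every component of such a forest has an unbounded type, so only back-and-forth types that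
  belong to unbounded types occur among its components, and each of these occurs at least \<open>s\<close> times.
\<close>

lemma large_component_forests_same_theory:
  assumes B: "\<forall>\<tau>\<in>component_types s. \<not> unbounded_type \<tau> \<longrightarrow> (\<forall>A\<in>\<tau>. card (pverts A) \<le> B)"
    and F: "F \<in> large_component_forests B s (unbounded_types s)"
    and H: "H \<in> large_component_forests B s (unbounded_types s)"
  shows "s_theory s F = s_theory s H"
proof -
  \<comment> \<open>the back-and-forth types that belong to unbounded component types\<close>
  define X where "X = {ef_type s A [] | A \<tau>. \<tau> \<in> unbounded_types s \<and> A \<in> \<tau>}"
  have "finite X"
    by (rule finite_subset[OF _ finitely_many_ef_types[of s 0, where 'a = nat]]) (auto simp: X_def)
  have "pair_graph G" if "G \<in> large_component_forests B s (unbounded_types s)" for G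
    using that by (simp add: large_component_forests_def is_forest_def)
  then have pg: "pair_graph F" "pair_graph H" using F H by auto
  have inX: "ef_type s (induced_on G C) [] \<in> X"
    if G: "G \<in> large_component_forests B s (unbounded_types s)" and C: "C \<in> components_of G" for G C
  proof -
    have "is_tree (induced_on G C)"
      using G by (intro is_tree_component[OF _ C]) (simp add: large_component_forests_def)
    then obtain \<tau> where \<tau>: "\<tau> \<in> component_types s" "induced_on G C \<in> \<tau>"
      using component_type_of_tree[of "induced_on G C" s] by blast
    have "unbounded_type \<tau>" by (rule no_bounded_components[OF B G C \<tau>])
    with \<tau> show ?thesis by (auto simp: X_def unbounded_types_def)
  qed
  have many: "s \<le> card {C \<in> components_of G. ef_type s (induced_on G C) [] = t}"
    if G: "G \<in> large_component_forests B s (unbounded_types s)" "pair_graph G" and "t \<in> X" for G t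
  proof -
    from \<open>t \<in> X\<close> obtain A \<tau> where A: "\<tau> \<in> unbounded_types s" "A \<in> \<tau>" "t = ef_type s A []"
      by (auto simp: X_def)
    then obtain A0 :: "nat pair_pre_digraph" where A0: "\<tau> = {B. is_tree B \<and> ef_type s B [] = ef_type s A0 []}"
      by (auto simp: unbounded_types_def elim: component_typesE)
    have "s \<le> num_components \<tau> G" using G A(1) by (simp add: large_component_forests_def)
    also have "\<dots> \<le> card {C \<in> components_of G. ef_type s (induced_on G C) [] = t}"
      unfolding num_components_def
    proof (rule card_mono)
      show "finite {C \<in> components_of G. ef_type s (induced_on G C) [] = t}"
        using closed_partition_components[OF G(2)] by (auto simp: closed_partition_def)
    qed (use A A0 in auto)
    finally show ?thesis .
  qed
  have "ef_type s F [] = ef_type s H []"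
    using inX many F H pg closed_partition_components
    by (intro ef_type_closed_partition[OF \<open>finite X\<close>, of F "components_of F" H "components_of H"]) auto
  then show ?thesis using pg by (intro s_theory_eqI) (auto simp: pair_graph_iff)
qed

text \<open>
  Some regime is needed to see that forests with only large components and many components of each
  unbounded type exist: they are then found among the pruned random graphs.
\<close>

lemma pruning_regime_exists: "\<exists>c f. pruning_regime c f"
proof (intro exI)
  let ?c = "\<lambda>n :: nat. 1 / ln (real n + 3)" and ?f = "\<lambda>n :: nat. nat \<lfloor>sqrt (ln (real n + 3))\<rfloor>"
  have ln1: "1 < ln (real n + 3)" for n
  proof -
    have "exp 1 < real n + 3" using e_less_272 of_nat_0_le_iff[of n, where 'a = real] by linarith
    then have "ln (exp 1) < ln (real n + 3)" by (subst ln_less_cancel_iff) auto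
    then show ?thesis by simp
  qed
  show "pruning_regime ?c ?f"
    unfolding pruning_regime_def
  proof (intro conjI allI impI)
    show "0 < ?c n" for n using ln1[of n] by simp
    show "?c \<longlonglongrightarrow> 0" by real_asymp
    show "1 \<le> ?f n" for n
    proof -
      have "1 \<le> sqrt (ln (real n + 3))" using ln1[of n] by simp
      then show ?thesis by (simp add: le_nat_iff le_floor_iff)
    qed
    show "filterlim ?f at_top sequentially" by real_asymp
    show "(\<lambda>n. real (?f n) * (ln (real (?f n)) + ln (1 / ?c n))) \<in> o(\<lambda>n. ln (real n))"
      by real_asymp
  qed
qed

section \<open>The zero-one law\<close>

theorem theorem1p2:
  shows
    "(\<forall>(c :: nat \<Rightarrow> real) (f :: nat \<Rightarrow> nat). pruning_regime c f \<longrightarrow>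
        zero_one_law (pruned_gnp c f) \<and>
        (\<forall>s K. whp (pruned_gnp c f)
           (\<lambda>G. is_forest G \<and>
                (\<forall>\<tau> \<in> component_types s. \<not> unbounded_type \<tau> \<longrightarrow>
                   \<not> (\<exists>C \<in> components_of G. induced_on G C \<in> \<tau>)) \<and>
                (\<forall>\<tau> \<in> component_types s. unbounded_type \<tau> \<longrightarrow> K \<le> num_components \<tau> G))) \<and>
        (\<forall>s. \<exists>F :: nat pair_pre_digraph. is_forest F \<and>
           whp (pruned_gnp c f) (\<lambda>G. s_theory s G = s_theory s F)))
   \<and> (\<forall>s. \<exists>B M \<Gamma> T.
        finite \<Gamma> \<and> \<Gamma> \<subseteq> {\<tau> \<in> component_types s. unbounded_type \<tau>} \<and>
        s_theory s ` large_component_forests B M \<Gamma> = {T} \<and>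
        (\<forall>(c :: nat \<Rightarrow> real) (f :: nat \<Rightarrow> nat). pruning_regime c f \<longrightarrow>
           whp (pruned_gnp c f) (\<lambda>G. s_theory s G = T)))"
proof -
  \<comment> \<open>\<open>M = s\<close> copies of each type suffice, and \<open>B s\<close> excludes all bounded types\<close>
  obtain B where B: "\<And>s. \<forall>\<tau>\<in>component_types s. \<not> unbounded_type \<tau> \<longrightarrow>
      (\<forall>A\<in>\<tau>. card (pverts A) \<le> B s)"
    using bounded_types_bound by metis
  define \<F> where "\<F> = (\<lambda>s. large_component_forests (B s) s (unbounded_types s))"
  obtain c\<^sub>0 f\<^sub>0 where "pruning_regime c\<^sub>0 f\<^sub>0" using pruning_regime_exists by blast
  then have "\<exists>F. F \<in> \<F> s" for s
    unfolding \<F>_def by (rule whp_satisfiable[OF whp_large_component_forest])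
  then obtain F where F: "\<And>s. F s \<in> \<F> s" by metis
  have same: "s_theory s G = s_theory s (F s)" if "G \<in> \<F> s" for s G
    using large_component_forests_same_theory[OF B] that F[of s] unfolding \<F>_def by blast
  have theory_whp: "whp (pruned_gnp c f) (\<lambda>G. s_theory s G = s_theory s (F s))"
    if "pruning_regime c f" for c f s
    using whp_large_component_forest[OF that, of "B s" s s] same[of _ s]
    by (elim whp_mono) (simp add: \<F>_def)
  show ?thesis
  proof (intro conjI allI impI)
    fix c f s K assume regime: "pruning_regime c f"
    have "whp (pruned_gnp c f) (\<lambda>G. G \<in> large_component_forests (B s) K (unbounded_types s))"
      by (rule whp_large_component_forest[OF regime])
    then show "whp (pruned_gnp c f)
           (\<lambda>G. is_forest G \<and>
                (\<forall>\<tau> \<in> component_types s. \<not> unbounded_type \<tau> \<longrightarrow>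
                   \<not> (\<exists>C \<in> components_of G. induced_on G C \<in> \<tau>)) \<and>
                (\<forall>\<tau> \<in> component_types s. unbounded_type \<tau> \<longrightarrow> K \<le> num_components \<tau> G))"
    proof (rule whp_mono, intro conjI)
      fix G assume G: "G \<in> large_component_forests (B s) K (unbounded_types s)"
      then show "is_forest G" "\<forall>\<tau> \<in> component_types s. unbounded_type \<tau> \<longrightarrow> K \<le> num_components \<tau> G"
        by (auto simp: large_component_forests_def unbounded_types_def)
      show "\<forall>\<tau> \<in> component_types s. \<not> unbounded_type \<tau> \<longrightarrow>
          \<not> (\<exists>C \<in> components_of G. induced_on G C \<in> \<tau>)"
        using no_bounded_components[OF B G] by blast
    qed
  next
    fix c f s assume regime: "pruning_regime c f"
    show "\<exists>F :: nat pair_pre_digraph. is_forest F \<and>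
           whp (pruned_gnp c f) (\<lambda>G. s_theory s G = s_theory s F)"
      using theory_whp[OF regime] F[of s] by (auto simp: \<F>_def large_component_forests_def)
  next
    fix c f assume regime: "pruning_regime c f"
    show "zero_one_law (pruned_gnp c f)"
      unfolding zero_one_law_def
    proof (intro allI impI)
      fix \<phi> assume \<phi>: "sentence \<phi>"
      define s where "s = quantifier_rank \<phi>"
      have iff: "models G \<phi> \<longleftrightarrow> \<phi> \<in> s_theory s G" for G :: "nat pair_pre_digraph"
        using \<phi> by (simp add: s_theory_def s_def)
      show "(\<lambda>n. measure_pmf.prob (pruned_gnp c f n) {G. models G \<phi>}) \<longlonglongrightarrow> 0 \<or>
          (\<lambda>n. measure_pmf.prob (pruned_gnp c f n) {G. models G \<phi>}) \<longlonglongrightarrow> 1"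
      proof (cases "\<phi> \<in> s_theory s (F s)")
        case True
        have "whp (pruned_gnp c f) (\<lambda>G. models G \<phi>)"
          using theory_whp[OF regime, of s] by (rule whp_mono) (simp add: iff True)
        then show ?thesis by (simp add: whp_def)
      next
        case False
        have "whp (pruned_gnp c f) (\<lambda>G. \<not> models G \<phi>)"
          using theory_whp[OF regime, of s] by (rule whp_mono) (simp add: iff False)
        then show ?thesis by (simp add: whp_iff)
      qed
    qed
  next
    fix s
    show "\<exists>B M \<Gamma> T.
        finite \<Gamma> \<and> \<Gamma> \<subseteq> {\<tau> \<in> component_types s. unbounded_type \<tau>} \<and>
        s_theory s ` large_component_forests B M \<Gamma> = {T} \<and>
        (\<forall>(c :: nat \<Rightarrow> real) (f :: nat \<Rightarrow> nat). pruning_regime c f \<longrightarrow>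
           whp (pruned_gnp c f) (\<lambda>G. s_theory s G = T))"
    proof (intro exI conjI allI impI)
      show "finite (unbounded_types s)" using finite_component_types by (simp add: unbounded_types_def)
      show "unbounded_types s \<subseteq> {\<tau> \<in> component_types s. unbounded_type \<tau>}"
        by (simp add: unbounded_types_def)
      show "s_theory s ` large_component_forests (B s) s (unbounded_types s) = {s_theory s (F s)}"
        using same[of _ s] F[of s] unfolding \<F>_def by blast
    qed (rule theory_whp)
  qed
qed

end
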